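(* (i) Let $X$ be a transient Lévy process on $S$, started at $0$, with Green operator $G$ and degree (of transience) $\gamma$ $(\ge 0)$. Assume that for any closed ball $K\subset S$ one has $\sup_{x\in K}G1_K(x)<\infty$, and that for any closed ball $C\subset K^\circ$ (interior of $K$) one has $\inf_{x\in C}G1_K(x)>0$. Then $$\gamma=\sup\{\zeta\ge 0:\ \mathbb E L_{B_R}^{\zeta}<\infty\ \text{ for all } R>0\},$$ where $B_R$ is the open ball of radius $R$ centered at $0$. (ii) If $X$ is an irreducible transient (continuous-time) random walk on a countable Abelian group, started at $0$, with degree $\gamma$, then $$\gamma=\sup\{\zeta\ge0:\ \mathbb E L^{\zeta}<\infty\},$$ where $L$ is the last exit time from $0$, that is, $L=\sup\{t\ge 0: X(t)=0\}$.
   Context: $S$ is a Polish (metric) space with an additive Abelian group structure. A Lévy process on $S$ is a process with stationary independent increments and càdlàg paths (for countable $S$: a continuous-time random walk). $\mathbb E_x$ is expectation for the process started at $x$ and $\mathbb E=\mathbb E_0$. $T_t\varphi(x)=\mathbb E_x\varphi(X(t))$; $G\varphi=\int_0^\infty T_t\varphi\,dt$; $G^{\zeta}\varphi=\frac1{\Gamma(\zeta)}\int_0^\infty t^{\zeta-1}T_t\varphi\,dt$ for $\zeta>0$. The degree of $X$ is $$\gamma=\sup\{\zeta>-1:\ G^{\zeta+1}\varphi<\infty\ \text{ for all bounded measurable } \varphi\ge0 \text{ with bounded support}\}.$$ $X$ is transient if $\sup_xG\varphi(x)<\infty$ for every nonnegative continuous $\varphi$ with bounded support. For a nonempty Borel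 set $A\subset S$, $L_A=\sup\{t\ge0:X(t)\in A\}$ is the last exit time from $A$ (with $L_A=0$ if $A$ is never visited). $1_A$ is the indicator function of $A$. *)

theory Defs
  imports "HOL-Probability.Probability"
begin

text \<open>
  Time is \<^typ>\<open>real\<close>; only the values \<open>X t\<close> with \<open>t \<ge> 0\<close> matter. The process starts at \<open>0\<close>; the
  process started at \<open>x\<close> is \<open>x + X t\<close>. For a countable group with the discrete topology these are
  the continuous-time random walks.
\<close>

locale levy_process = prob_space M
  for M :: "'w measure"
    and X :: "real \<Rightarrow> 'w \<Rightarrow> 'a :: {topological_space, ab_group_add}" +
  assumes measurable_X: "\<And>t. t \<ge> 0 \<Longrightarrow> X t \<in> M \<rightarrow>\<^sub>M borel"
    and start_0: "AE \<omega> in M. X 0 \<omega> = 0"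
    and independent_increments:
      "\<And>(t :: nat \<Rightarrow> real) n. t 0 \<ge> 0 \<Longrightarrow> mono t \<Longrightarrow>
         indep_vars (\<lambda>_. borel) (\<lambda>i \<omega>. X (t (Suc i)) \<omega> - X (t i) \<omega>) {..<n}"
    and stationary_increments:
      "\<And>s t. s \<ge> 0 \<Longrightarrow> t \<ge> 0 \<Longrightarrow>
         distr M borel (\<lambda>\<omega>. X (s + t) \<omega> - X s \<omega>) = distr M borel (X t)"
    and right_continuous:
      "\<And>\<omega> t. \<omega> \<in> space M \<Longrightarrow> t \<ge> 0 \<Longrightarrow> ((\<lambda>s. X s \<omega>) \<longlongrightarrow> X t \<omega>) (at_right t)"
    and left_limits:
      "\<And>\<omega> t. \<omega> \<in> space M \<Longrightarrow> t > 0 \<Longrightarrow> \<exists>l. ((\<lambda>s. X s \<omega>) \<longlongrightarrow> l) (at_left t)"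

definition transition ::
  "'w measure \<Rightarrow> (real \<Rightarrow> 'w \<Rightarrow> 'a :: ab_group_add) \<Rightarrow> real \<Rightarrow> ('a \<Rightarrow> ennreal) \<Rightarrow> 'a \<Rightarrow> ennreal"
where
  "transition M X t \<phi> x = (\<integral>\<^sup>+\<omega>. \<phi> (x + X t \<omega>) \<partial>M)"

definition green ::
  "'w measure \<Rightarrow> (real \<Rightarrow> 'w \<Rightarrow> 'a :: ab_group_add) \<Rightarrow> ('a \<Rightarrow> ennreal) \<Rightarrow> 'a \<Rightarrow> ennreal"
where
  "green M X \<phi> x = (\<integral>\<^sup>+t\<in>{0..}. transition M X t \<phi> x \<partial>lborel)"

definition green_power ::
  "'w measure \<Rightarrow> (real \<Rightarrow> 'w \<Rightarrow> 'a :: ab_group_add) \<Rightarrow> real \<Rightarrow> ('a \<Rightarrow> ennreal) \<Rightarrow> 'a \<Rightarrow> ennreal"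
where
  "green_power M X \<zeta> \<phi> x =
     ennreal (1 / Gamma \<zeta>) *
       (\<integral>\<^sup>+t\<in>{0..}. ennreal (t powr (\<zeta> - 1)) * transition M X t \<phi> x \<partial>lborel)"

text \<open>
  The parameter \<open>bdd\<close> says which subsets of the state space are bounded: \<^const>\<open>bounded\<close> on a
  metric space, \<^const>\<open>finite\<close> on a countable group, where no metric is given.
\<close>

definition degree_of_transience ::
  "('a set \<Rightarrow> bool) \<Rightarrow> 'w measure \<Rightarrow> (real \<Rightarrow> 'w \<Rightarrow> 'a :: {topological_space, ab_group_add}) \<Rightarrow> ereal"
where
  "degree_of_transience bdd M X =
     Sup {ereal \<zeta> |\<zeta>. \<zeta> > -1 \<and>
       (\<forall>\<phi> :: 'a \<Rightarrow> real. \<phi> \<in> borel_measurable borel \<and> (\<forall>x. \<phi> x \<ge> 0) \<and>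
          bounded (range \<phi>) \<and> bdd {x. \<phi> x \<noteq> 0} \<longrightarrow>
          (\<forall>x. green_power M X (\<zeta> + 1) (\<lambda>y. ennreal (\<phi> y)) x < \<infinity>))}"

definition transient ::
  "('a set \<Rightarrow> bool) \<Rightarrow> 'w measure \<Rightarrow> (real \<Rightarrow> 'w \<Rightarrow> 'a :: {topological_space, ab_group_add}) \<Rightarrow> bool"
where
  "transient bdd M X \<longleftrightarrow>
     (\<forall>\<phi> :: 'a \<Rightarrow> real. continuous_on UNIV \<phi> \<and> (\<forall>x. \<phi> x \<ge> 0) \<and> bdd {x. \<phi> x \<noteq> 0} \<longrightarrow>
        (SUP x. green M X (\<lambda>y. ennreal (\<phi> y)) x) < \<infinity>)"

definition irreducible_walk ::
  "'w measure \<Rightarrow> (real \<Rightarrow> 'w \<Rightarrow> 'a :: ab_group_add) \<Rightarrow> bool"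
where
  "irreducible_walk M X \<longleftrightarrow>
     (\<forall>x y. \<exists>t\<ge>0. measure M {\<omega> \<in> space M. x + X t \<omega> = y} > 0)"

text \<open>The supremum of the empty set is \<open>0\<close> in \<^typ>\<open>ennreal\<close>, so a set never visited has last exit time \<open>0\<close>.\<close>

definition last_exit :: "(real \<Rightarrow> 'w \<Rightarrow> 'a) \<Rightarrow> 'a set \<Rightarrow> 'w \<Rightarrow> ennreal" where
  "last_exit X A \<omega> = Sup {ennreal t |t. t \<ge> 0 \<and> X t \<omega> \<in> A}"

definition ennreal_powr :: "ennreal \<Rightarrow> real \<Rightarrow> ennreal" where
  "ennreal_powr a \<zeta> =
     (if \<zeta> = 0 then 1 else if a = \<infinity> then \<infinity> else ennreal (enn2real a powr \<zeta>))"

end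

(* Let A(T) be the event that X visits the open set B after time T. Stopping at the first visit
   and using the Markov property, the expected occupation time of K after T on A(T) is at least
   P(A(T)) inf_B G1_K, and for K = B it is at most P(A(T)) sup_B G1_B. Integrating against
   z T^(z-1) dT turns P(A(T)) = P(L_B > T) into E L_B^z, and the occupation time
   int_T^oo P(X(s) in K) ds into int s^z P(X(s) in K) ds = Gamma(z+1) G^(z+1) 1_K (0). So the
   moments of the last exit times are finite exactly when the fractional Green potentials are.
   The strong Markov property is avoided: first visits are taken along dyadic time grids, and
   right continuity of the paths gives the limit of vanishing mesh. *)

theory Submission
  imports Defs
begin

section \<open>Joint measurability and the Markov property\<close>

text \<open>All comparisons are made at a fixed T and then integrated against one and the same
  weight, so no tail asymptotics are needed. At a grid visit the path is in B itself, whereas at the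
  infimum of the visiting times it may be only in the closure; bounds on B therefore suffice. The
  price is that a grid notices a visit slightly late. This costs nothing in the lower bound, since
  the union over all grids is the full hitting event, and at most one time per path, a null set, in
  the upper bound. The weight z T^(z-1) demands z > 0. At z = 0 both finiteness conditions hold by
  the hypotheses, and then the exponents in (-1,0) cannot affect the supremum. In part (i) the lower
  bound needs a set K larger than B, so finiteness is compared for the whole family of balls and not
  ball by ball. In part (ii) the set {0} is open and has one point, so a single constant serves both
  bounds; irreducibility then carries finiteness from {0} to all finite sets.\<close>

text \<open>
  Polish groups and countable discrete groups have no common type class in which addition is
  Borel measurable and limits of measurable functions are measurable; the locale axioms supply
  what replaces it. The second one reduces the joint measurability of \<open>(t, \<omega>) \<mapsto> X t \<omega>\<close> to
  real-valued right-continuous paths. As \<open>X t\<close> is unconstrained for \<open>t < 0\<close>, measurability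
  statements are about \<open>X (max 0 t)\<close>.
\<close>

locale regular_levy_process = levy_process M X
  for M :: "'w measure"
    and X :: "real \<Rightarrow> 'w \<Rightarrow> 'a :: {topological_space, ab_group_add}" +
  assumes measurable_plus: "(\<lambda>p. fst p + snd p :: 'a) \<in> borel \<Otimes>\<^sub>M borel \<rightarrow>\<^sub>M borel"
    and open_imp_cozero:
      "\<And>U :: 'a set. open U \<Longrightarrow> \<exists>f. continuous_on UNIV f \<and> U = {x. f x > (0::real)}"
begin

lemma measurable_add [measurable (raw)]:
  assumes "f \<in> borel_measurable L" "g \<in> borel_measurable L"
  shows "(\<lambda>x. f x + g x :: 'a) \<in> borel_measurable L"
  using measurable_compose[OF measurable_Pair[OF assms] measurable_plus] by simp

lemma measurable_sum_fun:
  assumes "finite I" "I \<noteq> {}" "\<And>i. i \<in> I \<Longrightarrow> f i \<in> borel_measurable L"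
  shows "(\<lambda>x. \<Sum>i\<in>I. f i x :: 'a) \<in> borel_measurable L"
  using assms
proof (induction I rule: finite_ne_induct)
  case (insert i I)
  then have "(\<lambda>x. f i x + (\<Sum>i\<in>I. f i x)) \<in> borel_measurable L"
    by (intro measurable_add) auto
  with insert show ?case by simp
qed auto

lemma measurable_X_max [measurable]: "X (max 0 t) \<in> borel_measurable M"
  by (rule measurable_X) simp

lemma right_continuous_at:
  assumes "\<omega> \<in> space M" "t \<ge> 0" "open U" "X t \<omega> \<in> U"
  obtains e where "e > 0" "\<And>s. t \<le> s \<Longrightarrow> s < t + e \<Longrightarrow> X s \<omega> \<in> U"
proof -
  have "eventually (\<lambda>s. X s \<omega> \<in> U) (at_right t)"
    using right_continuous[OF assms(1,2)] assms(3,4) by (simp add: tendsto_def)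
  then obtain b where "b > t" "\<And>s. t < s \<Longrightarrow> s < b \<Longrightarrow> X s \<omega> \<in> U"
    by (auto simp: eventually_at_right_field)
  with assms(4) show thesis
    by (intro that[of "b - t"]) (auto simp: le_less)
qed

text \<open>Rounding the time to a countable grid gives approximants that are measurable by
  splitting over the grid index. Composition with a continuous real function \<open>f\<close> makes
  their limit a limit of real functions, and the preimage of an open set is that of {f > 0}.\<close>

lemma measurable_path [measurable]:
  "(\<lambda>p. X (max 0 (fst p)) (snd p)) \<in> borel_measurable ((borel :: real measure) \<Otimes>\<^sub>M M)"
proof (rule borel_measurableI)
  fix U :: "'a set" assume "open U"
  then obtain f where f: "continuous_on UNIV f" and U: "U = {x. f x > (0::real)}"
    using open_imp_cozero by blast
  have [measurable]: "f \<in> borel_measurable borel"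
    using f by (rule borel_measurable_continuous_onI)
  \<comment> \<open>\<open>q n t\<close> is the least multiple of 1/(n+1) strictly above t (for t
    \<ge> 0). Strictness matters: right continuity is a limit along \<open>at_right t\<close>, which
    excludes t.\<close>
  define q where "q = (\<lambda>(n :: nat) (t :: real). (real (nat \<lfloor>t * real (Suc n)\<rfloor>) + 1) / real (Suc n))"
  have q: "t < q n t \<and> q n t \<le> t + 1 / real (Suc n)" if "t \<ge> 0" for n t
  proof -
    have nn: "0 \<le> t * real (Suc n)" using that by simp
    have "real (nat \<lfloor>t * real (Suc n)\<rfloor>) = of_int \<lfloor>t * real (Suc n)\<rfloor>"
      using nn by simp
    then have "t * real (Suc n) < real (nat \<lfloor>t * real (Suc n)\<rfloor>) + 1"
        "real (nat \<lfloor>t * real (Suc n)\<rfloor>) \<le> t * real (Suc n)"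
      by linarith+
    then have "t < q n t" "real (nat \<lfloor>t * real (Suc n)\<rfloor>) / real (Suc n) \<le> t"
      unfolding q_def by (simp_all only: pos_less_divide_eq pos_divide_le_eq of_nat_0_less_iff zero_less_Suc)
    then show ?thesis unfolding q_def add_divide_distrib by linarith
  qed
  have "(\<lambda>p. f (X (max 0 (fst p)) (snd p))) \<in> borel_measurable ((borel :: real measure) \<Otimes>\<^sub>M M)"
  proof (rule borel_measurable_LIMSEQ_real)
    fix p assume "p \<in> space ((borel :: real measure) \<Otimes>\<^sub>M M)"
    then have \<omega>: "snd p \<in> space M" by (auto simp: space_pair_measure)
    define t where "t = max 0 (fst p)"
    have t: "t \<ge> 0" by (simp add: t_def)
    have "filterlim (\<lambda>n. q n t) (at_right t) sequentially"
    proof (rule filterlim_at_withinI)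
      have lim: "(\<lambda>n. t + 1 / real (Suc n)) \<longlonglongrightarrow> t"
        using tendsto_add[OF tendsto_const LIMSEQ_Suc[OF lim_1_over_n]] by simp
      have "\<forall>n. t \<le> q n t" "\<forall>n. q n t \<le> t + 1 / real (Suc n)"
        using q[OF t] by (simp_all add: less_imp_le)
      then show "(\<lambda>n. q n t) \<longlonglongrightarrow> t"
        by (intro tendsto_sandwich[OF _ _ tendsto_const lim]) simp_all
      have "\<forall>n. q n t \<in> {t<..} - {t}"
        using q[OF t] by (simp add: less_imp_neq[THEN not_sym])
      then show "\<forall>\<^sub>F n in sequentially. q n t \<in> {t<..} - {t}"
        by (rule always_eventually)
    qed
    with right_continuous[OF \<omega> t] have "(\<lambda>n. X (q n t) (snd p)) \<longlonglongrightarrow> X t (snd p)"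
      by (rule filterlim_compose)
    then show "(\<lambda>n. f (X (q n (max 0 (fst p))) (snd p))) \<longlonglongrightarrow> f (X (max 0 (fst p)) (snd p))"
      unfolding t_def[symmetric] by (intro continuous_on_tendsto_compose[OF f]) simp_all
  next
    fix n
    have "(\<lambda>p. f (X (max 0 ((real (nat \<lfloor>max 0 (fst p) * real (Suc n)\<rfloor>) + 1) / real (Suc n))) (snd p)))
        \<in> borel_measurable ((borel :: real measure) \<Otimes>\<^sub>M M)"
      by (rule measurable_compose_countable
          [where f = "\<lambda>i p. f (X (max 0 ((real i + 1) / real (Suc n))) (snd p))"]) measurable
    moreover have "max 0 (q n (max 0 t)) = q n (max 0 t)" for t
      using q[of "max 0 t" n] by auto
    ultimately show "(\<lambda>p. f (X (q n (max 0 (fst p))) (snd p))) \<in> borel_measurable ((borel :: real measure) \<Otimes>\<^sub>M M)"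
      unfolding q_def by simp
  qed
  then have "{p \<in> space ((borel :: real measure) \<Otimes>\<^sub>M M). f (X (max 0 (fst p)) (snd p)) > 0} \<in> sets ((borel :: real measure) \<Otimes>\<^sub>M M)"
    by measurable
  also have "{p \<in> space ((borel :: real measure) \<Otimes>\<^sub>M M). f (X (max 0 (fst p)) (snd p)) > 0} =
      (\<lambda>p. X (max 0 (fst p)) (snd p)) -` U \<inter> space ((borel :: real measure) \<Otimes>\<^sub>M M)"
    unfolding U by auto
  finally show "(\<lambda>p. X (max 0 (fst p)) (snd p)) -` U \<inter> space ((borel :: real measure) \<Otimes>\<^sub>M M) \<in> sets ((borel :: real measure) \<Otimes>\<^sub>M M)" .
qed

lemma measurable_path_raw [measurable (raw)]:
  assumes [measurable]: "f \<in> borel_measurable L" "g \<in> L \<rightarrow>\<^sub>M M"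
  shows "(\<lambda>x. X (max 0 (f x)) (g x)) \<in> borel_measurable L"
  using measurable_compose[OF measurable_Pair[OF assms] measurable_path] by simp

lemma measurable_transition [measurable (raw)]:
  assumes [measurable]: "\<phi> \<in> borel_measurable borel" "f \<in> borel_measurable L" "g \<in> borel_measurable L"
  shows "(\<lambda>x. transition M X (max 0 (f x)) \<phi> (g x)) \<in> borel_measurable L"
  unfolding transition_def by measurable

lemma green_eq:
  "green M X \<phi> x = (\<integral>\<^sup>+u. transition M X (max 0 u) \<phi> x * indicator {0..} u \<partial>lborel)"
  unfolding green_def by (intro nn_integral_cong) (auto split: split_indicator)

text \<open>The positions up to index k are a function of the first k increments. The increment over
  the further time u is independent of these and distributed as \<open>X u\<close>, so it can be
  integrated out by Fubini.\<close>

theorem markov_property: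
  fixes t :: "nat \<Rightarrow> real"
  assumes t0: "t 0 = 0" and mono: "mono t" and u: "u \<ge> 0"
    and g: "g \<in> borel_measurable (PiM {..k} (\<lambda>_. borel))"
    and \<phi> [measurable]: "\<phi> \<in> borel_measurable borel"
  shows "(\<integral>\<^sup>+\<omega>. g (\<lambda>i\<in>{..k}. X (t i) \<omega>) * \<phi> (X (t k + u) \<omega>) \<partial>M) =
    (\<integral>\<^sup>+\<omega>. g (\<lambda>i\<in>{..k}. X (t i) \<omega>) * transition M X u \<phi> (X (t k) \<omega>) \<partial>M)"
proof -
  \<comment> \<open>Freezing the sequence at t k + u after index k makes the last increment of
    interest, \<open>D k\<close>, part of one monotone sequence.\<close>
  define t' where "t' i = (if i \<le> k then t i else t k + u)" for i
  have t'0: "t' 0 \<ge> 0" using t0 by (simp add: t'_def)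
  have tk: "t k \<ge> 0" using monoD[OF mono, of 0 k] t0 by simp
  have mono': "mono t'"
    unfolding t'_def mono_def using monoD[OF mono] u tk by (auto intro: add_increasing2)
  define D where "D i \<omega> = X (t' (Suc i)) \<omega> - X (t' i) \<omega>" for i \<omega>
  define R where "R \<omega> = restrict (\<lambda>i. D i \<omega>) {..<k}" for \<omega>
  define P where "P = PiM {..<k} (\<lambda>_. borel :: 'a measure)"
  define Q where "Q = PiM {..k} (\<lambda>_. borel :: 'a measure)"
  \<comment> \<open>\<open>S\<close> rebuilds the positions as partial sums of increments, which is
    correct almost surely because X 0 = 0. Entry 0 is split off since
    \<open>measurable_sum_fun\<close> asks for a nonempty index set.\<close>
  define S where "S r = (\<lambda>i\<in>{..k}. if i = 0 then 0 else (\<Sum>j<i. r j))" for r :: "nat \<Rightarrow> 'a"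
  have iv: "indep_vars (\<lambda>_. borel) D {..<Suc k}"
    unfolding D_def by (rule independent_increments[OF t'0 mono'])
  define P' where "P' = PiM {k} (\<lambda>_. borel :: 'a measure)"
  define R' where "R' \<omega> = restrict (\<lambda>i. D i \<omega>) {k}" for \<omega>
  have "indep_var P R P' R'"
    unfolding P_def P'_def R_def R'_def by (rule indep_var_restrict[OF iv]) auto
  then have R [measurable]: "R \<in> M \<rightarrow>\<^sub>M P" and R' [measurable]: "R' \<in> M \<rightarrow>\<^sub>M P'"
    and joint: "distr M P R \<Otimes>\<^sub>M distr M P' R' = distr M (P \<Otimes>\<^sub>M P') (\<lambda>\<omega>. (R \<omega>, R' \<omega>))"
    by (simp_all add: indep_var_distribution_eq)
  have P'k [measurable]: "(\<lambda>r. r k) \<in> borel_measurable P'"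
    unfolding P'_def by (rule measurable_component_singleton) simp
  have R'k: "R' \<omega> k = D k \<omega>" for \<omega> by (simp add: R'_def)
  have D [measurable]: "D k \<in> borel_measurable M"
    using measurable_compose[OF R' P'k] by (simp add: R'k)
  have law: "distr M borel (D k) = distr M borel (X u)"
  proof -
    have "D k = (\<lambda>\<omega>. X (t k + u) \<omega> - X (t k) \<omega>)" by (auto simp: D_def t'_def)
    then show ?thesis using stationary_increments[OF tk u] by simp
  qed
  have S [measurable]: "S \<in> P \<rightarrow>\<^sub>M Q"
    unfolding S_def P_def Q_def
  proof (rule measurable_restrict)
    fix i assume "i \<in> {..k}"
    then show "(\<lambda>r. if i = 0 then 0 else \<Sum>j<i. r j) \<in> borel_measurable (PiM {..<k} (\<lambda>_. borel :: 'a measure))"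
      by (cases "i = 0") (auto intro!: measurable_sum_fun)
  qed
  have Sk [measurable]: "(\<lambda>r. S r k) \<in> borel_measurable P"
    using measurable_compose[OF S, of "\<lambda>r. r k" borel] by (simp add: Q_def)
  have gQ [measurable]: "g \<in> borel_measurable Q" using g by (simp add: Q_def)
  have SR: "AE \<omega> in M. S (R \<omega>) = (\<lambda>i\<in>{..k}. X (t i) \<omega>)"
    using start_0
  proof eventually_elim
    case (elim \<omega>)
    have "(\<Sum>j<i. R \<omega> j) = X (t i) \<omega>" if "i \<le> k" for i
    proof -
      have "(\<Sum>j<i. R \<omega> j) = (\<Sum>j<i. X (t' (Suc j)) \<omega> - X (t' j) \<omega>)"
        using that by (intro sum.cong) (auto simp: R_def D_def)
      also have "\<dots> = X (t' i) \<omega> - X (t' 0) \<omega>" by (rule sum_lessThan_telescope)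
      finally show ?thesis using that elim t0 by (simp add: t'_def)
    qed
    then show ?case unfolding S_def using elim t0 by (auto simp: fun_eq_iff restrict_def)
  qed
  have Xu [measurable]: "X u \<in> borel_measurable M" by (rule measurable_X[OF u])
  have Xtk [measurable]: "X (t k) \<in> borel_measurable M" by (rule measurable_X[OF tk])
  interpret R: prob_space "distr M P R" by (rule prob_space_distr) fact
  interpret R': prob_space "distr M P' R'" by (rule prob_space_distr) fact
  have split: "X (t k + u) \<omega> = X (t k) \<omega> + D k \<omega>" for \<omega>
    by (simp add: D_def t'_def)
  have "(\<integral>\<^sup>+\<omega>. g (\<lambda>i\<in>{..k}. X (t i) \<omega>) * \<phi> (X (t k + u) \<omega>) \<partial>M) =
      (\<integral>\<^sup>+\<omega>. g (S (R \<omega>)) * \<phi> (S (R \<omega>) k + R' \<omega> k) \<partial>M)"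
    using SR by (intro nn_integral_cong_AE) (auto elim!: eventually_mono simp: split R'k)
  also have "\<dots> = (\<integral>\<^sup>+z. g (S (fst z)) * \<phi> (S (fst z) k + snd z k)
      \<partial>distr M (P \<Otimes>\<^sub>M P') (\<lambda>\<omega>. (R \<omega>, R' \<omega>)))"
    by (subst nn_integral_distr) simp_all
  also have "\<dots> = (\<integral>\<^sup>+z. g (S (fst z)) * \<phi> (S (fst z) k + snd z k)
      \<partial>(distr M P R \<Otimes>\<^sub>M distr M P' R'))"
    by (simp only: joint)
  also have "\<dots> = (\<integral>\<^sup>+r. \<integral>\<^sup>+r'. g (S r) * \<phi> (S r k + r' k) \<partial>distr M P' R' \<partial>distr M P R)"
    by (subst R'.nn_integral_fst[symmetric]) simp_all
  also have "\<dots> = (\<integral>\<^sup>+r. g (S r) * transition M X u \<phi> (S r k) \<partial>distr M P R)"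
  proof (intro nn_integral_cong)
    fix r
    have "(\<integral>\<^sup>+r'. g (S r) * \<phi> (S r k + r' k) \<partial>distr M P' R') =
        g (S r) * (\<integral>\<^sup>+r'. \<phi> (S r k + r' k) \<partial>distr M P' R')"
      by (intro nn_integral_cmult) simp
    also have "(\<integral>\<^sup>+r'. \<phi> (S r k + r' k) \<partial>distr M P' R') = (\<integral>\<^sup>+\<omega>. \<phi> (S r k + D k \<omega>) \<partial>M)"
      by (subst nn_integral_distr) (simp_all add: R'k)
    also have "\<dots> = (\<integral>\<^sup>+y. \<phi> (S r k + y) \<partial>distr M borel (D k))"
      by (subst nn_integral_distr) simp_all
    also have "\<dots> = transition M X u \<phi> (S r k)"
      unfolding law transition_def by (subst nn_integral_distr) simp_all
    finally show "(\<integral>\<^sup>+r'. g (S r) * \<phi> (S r k + r' k) \<partial>distr M P' R') =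
        g (S r) * transition M X u \<phi> (S r k)" .
  qed
  also have "\<dots> = (\<integral>\<^sup>+\<omega>. g (S (R \<omega>)) * transition M X u \<phi> (S (R \<omega>) k) \<partial>M)"
  proof (rule nn_integral_distr[OF R])
    have "(\<lambda>r. transition M X (max 0 u) \<phi> (S r k)) \<in> borel_measurable P" by measurable
    then show "(\<lambda>r. g (S r) * transition M X u \<phi> (S r k)) \<in> borel_measurable (distr M P R)"
      using u by (simp add: max_absorb2)
  qed
  also have "\<dots> = (\<integral>\<^sup>+\<omega>. g (\<lambda>i\<in>{..k}. X (t i) \<omega>) * transition M X u \<phi> (X (t k) \<omega>) \<partial>M)"
    using SR by (intro nn_integral_cong_AE) (auto elim!: eventually_mono)
  finally show ?thesis .
qed

end

section \<open>Occupation times after hitting an open set\<close>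

context levy_process
begin

text \<open>
  Only the indices \<open>k \<ge> 1\<close> are grid points; index \<open>0\<close> is the time \<open>0\<close>, from which the
  Markov property for a sequence of times starts.
\<close>

definition grid :: "real \<Rightarrow> nat \<Rightarrow> nat \<Rightarrow> real" where
  "grid T m k = (if k = 0 then 0 else T + real k / 2 ^ m)"

definition first_hit :: "'a set \<Rightarrow> real \<Rightarrow> nat \<Rightarrow> nat \<Rightarrow> 'w set" where
  "first_hit B T m k =
     {\<omega> \<in> space M. X (grid T m k) \<omega> \<in> B \<and> (\<forall>j\<in>{1..<k}. X (grid T m j) \<omega> \<notin> B)}"

text \<open>As s varies, this is the stochastic interval from the first grid visit onwards,
  expressed without a random time.\<close>

definition hit_by :: "'a set \<Rightarrow> real \<Rightarrow> nat \<Rightarrow> real \<Rightarrow> 'w set" where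
  "hit_by B T m s =
     {\<omega> \<in> space M. \<exists>k. grid T m (Suc k) \<le> s \<and> X (grid T m (Suc k)) \<omega> \<in> B}"

definition hit_after :: "'a set \<Rightarrow> real \<Rightarrow> 'w set" where
  "hit_after B T = {\<omega> \<in> space M. \<exists>s>T. X s \<omega> \<in> B}"

lemma mono_grid: "T \<ge> 0 \<Longrightarrow> mono (grid T m)"
  by (auto simp: mono_def grid_def divide_right_mono)

lemma grid_nonneg: "T \<ge> 0 \<Longrightarrow> grid T m k \<ge> 0"
  by (simp add: grid_def)

lemma grid_gt: "grid T m (Suc k) > T"
  by (simp add: grid_def)

text \<open>\<open>Suc (2 * k + 1)\<close> is twice \<open>Suc k\<close>: the dyadic grids are
  nested, so a finer grid misses no visit seen by a coarser one.\<close>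

lemma grid_refine: "grid T (Suc m) (Suc (2 * k + 1)) = grid T m (Suc k)"
  by (simp add: grid_def field_simps)

lemma hit_by_mono: "hit_by B T m s \<subseteq> hit_by B T (Suc m) s"
  unfolding hit_by_def by (auto simp del: mult_Suc_right) (metis grid_refine)

lemma first_hit_disjoint: "disjoint_family (\<lambda>k. first_hit B T m (Suc k))"
proof -
  have "first_hit B T m (Suc k) \<inter> first_hit B T m (Suc l) = {}" if "k < l" for k l
    using that by (fastforce simp: first_hit_def)
  then show ?thesis
    by (auto simp: disjoint_family_on_def) (metis disjoint_iff linorder_neqE_nat)
qed

lemma hit_by_iff_first_hit:
  "T \<ge> 0 \<Longrightarrow> \<omega> \<in> hit_by B T m s \<longleftrightarrow> (\<exists>k. \<omega> \<in> first_hit B T m (Suc k) \<and> grid T m (Suc k) \<le> s)"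
proof
  assume "T \<ge> 0" "\<omega> \<in> hit_by B T m s"
  then obtain k where k: "\<omega> \<in> space M" "grid T m (Suc k) \<le> s" "X (grid T m (Suc k)) \<omega> \<in> B"
    by (auto simp: hit_by_def)
  define l where "l = (LEAST l. X (grid T m (Suc l)) \<omega> \<in> B)"
  have l: "X (grid T m (Suc l)) \<omega> \<in> B" and "l \<le> k"
    unfolding l_def by (rule LeastI Least_le, fact)+
  moreover have "X (grid T m j) \<omega> \<notin> B" if j: "j \<in> {1..<Suc l}" for j
  proof -
    obtain i where "j = Suc i" "i < l" using j by (cases j) auto
    then show ?thesis
      using not_less_Least[of i "\<lambda>l. X (grid T m (Suc l)) \<omega> \<in> B"] by (simp add: l_def)
  qed
  moreover have "grid T m (Suc l) \<le> s"
    using k(2) monoD[OF mono_grid[OF \<open>T \<ge> 0\<close>], of "Suc l" "Suc k"] \<open>l \<le> k\<close> by (force intro: order_trans)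
  ultimately show "\<exists>k. \<omega> \<in> first_hit B T m (Suc k) \<and> grid T m (Suc k) \<le> s"
    using k(1) by (auto simp: first_hit_def)
qed (auto simp: hit_by_def first_hit_def)

end

context regular_levy_process
begin

lemma sets_first_hit:
  assumes [measurable]: "B \<in> sets borel" and T: "T \<ge> 0"
  shows "first_hit B T m k \<in> sets M"
proof -
  have "first_hit B T m k = {\<omega> \<in> space M. X (max 0 (grid T m k)) \<omega> \<in> B \<and>
      (\<forall>j\<in>{1..<k}. X (max 0 (grid T m j)) \<omega> \<notin> B)}"
    using grid_nonneg[OF T] by (simp add: first_hit_def max_absorb2)
  also have "\<dots> \<in> sets M" by measurable
  finally show ?thesis .
qed

text \<open>Right continuity keeps the path in the open set B for a while after s, and a fine grid
  has a point in that stretch. The point may come after s itself, hence the later time s'.\<close>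

lemma hit_by_of_hit:
  assumes \<omega>: "\<omega> \<in> space M" and T: "0 \<le> T" "T < s" and s': "s < s'"
    and B: "open B" "X s \<omega> \<in> B"
  shows "\<exists>m. \<omega> \<in> hit_by B T m s'"
proof -
  obtain e where e: "e > 0" "\<And>r. s \<le> r \<Longrightarrow> r < s + e \<Longrightarrow> X r \<omega> \<in> B"
    using right_continuous_at[OF \<omega> _ B] T by auto
  obtain m where m: "(1 / 2 :: real) ^ m < min e (s' - s)"
    using real_arch_pow_inv[of "min e (s' - s)" "1 / 2"] e(1) s' by auto
  \<comment> \<open>\<open>Suc k\<close> is the ceiling of (s - T) 2^m, so its grid point is the
    first one at or after s. As T < s, the ceiling is at least 1 and \<open>nat\<close> truncates
    nothing.\<close>
  define k where "k = nat (\<lceil>(s - T) * 2 ^ m\<rceil> - 1)"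
  have "(s - T) * 2 ^ m > 0" using T by simp
  then have "\<lceil>(s - T) * 2 ^ m\<rceil> \<ge> 1" by linarith
  then have "real (Suc k) = of_int \<lceil>(s - T) * 2 ^ m\<rceil>" by (simp add: k_def)
  then have "(s - T) * 2 ^ m \<le> real (Suc k)" "real (Suc k) < (s - T) * 2 ^ m + 1"
    by linarith+
  then have "s - T \<le> real (Suc k) / 2 ^ m" "real (Suc k) / 2 ^ m < s - T + (1 / 2) ^ m"
    by (simp_all add: field_simps power_one_over del: of_nat_Suc)
  then have g: "s \<le> grid T m (Suc k)" "grid T m (Suc k) < s + (1 / 2) ^ m"
    unfolding grid_def by simp_all
  with m have "grid T m (Suc k) \<le> s'" "X (grid T m (Suc k)) \<omega> \<in> B"
    by (auto intro!: e(2))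
  with \<omega> show ?thesis by (auto simp: hit_by_def)
qed

text \<open>An uncountable union over times becomes a countable one; this is the source of the
  measurability of \<open>hit_after\<close> and of \<open>last_exit\<close>.\<close>

lemma hit_after_eq:
  assumes "T \<ge> 0" "open B"
  shows "hit_after B T = (\<Union>m k. first_hit B T m (Suc k))"
proof (intro set_eqI iffI)
  fix \<omega> assume "\<omega> \<in> hit_after B T"
  then obtain s where "\<omega> \<in> space M" "s > T" "X s \<omega> \<in> B" by (auto simp: hit_after_def)
  then obtain m where "\<omega> \<in> hit_by B T m (s + 1)"
    using hit_by_of_hit[of \<omega> T s "s + 1" B] assms by auto
  then show "\<omega> \<in> (\<Union>m k. first_hit B T m (Suc k))"
    using assms by (auto simp: hit_by_iff_first_hit)
next
  fix \<omega> assume "\<omega> \<in> (\<Union>m k. first_hit B T m (Suc k))"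
  then show "\<omega> \<in> hit_after B T"
    using grid_gt by (fastforce simp: hit_after_def first_hit_def)
qed

lemma sets_hit_after: "T \<ge> 0 \<Longrightarrow> open B \<Longrightarrow> hit_after B T \<in> sets M"
  by (auto simp: hit_after_eq intro!: sets.countable_UN' sets_first_hit)

lemma incseq_grid_hit:
  assumes "T \<ge> 0"
  shows "incseq (\<lambda>m. \<Union>k. first_hit B T m (Suc k))"
proof (rule incseq_SucI, rule subsetI)
  fix m \<omega> assume "\<omega> \<in> (\<Union>k. first_hit B T m (Suc k))"
  then obtain k where "\<omega> \<in> first_hit B T m (Suc k)" by auto
  then have "\<omega> \<in> hit_by B T m (grid T m (Suc k))" using assms by (auto simp: hit_by_iff_first_hit)
  with hit_by_mono[of B T m "grid T m (Suc k)"]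
  have "\<omega> \<in> hit_by B T (Suc m) (grid T m (Suc k))" by auto
  then show "\<omega> \<in> (\<Union>k. first_hit B T (Suc m) (Suc k))"
    using assms by (auto simp: hit_by_iff_first_hit)
qed

text \<open>The event is decided by the positions at the grid times up to index k, so the Markov
  property at the deterministic time \<open>grid T m k\<close> applies. Shifting time by that amount
  and exchanging the integrals assembles the transition functions into \<open>green\<close>.\<close>

lemma occupation_after_first_hit:
  assumes B: "open B" and K [measurable]: "K \<in> sets borel" and T: "T \<ge> 0"
  shows "(\<integral>\<^sup>+s. (\<integral>\<^sup>+\<omega>. indicator (first_hit B T m k) \<omega> * indicator K (X (max 0 s) \<omega>) \<partial>M) *
        indicator {grid T m k..} s \<partial>lborel) =
    (\<integral>\<^sup>+\<omega>. indicator (first_hit B T m k) \<omega> * green M X (indicator K) (X (grid T m k) \<omega>) \<partial>M)"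
proof -
  let ?t = "grid T m k"
  have [measurable]: "B \<in> sets borel" using B by simp
  have [measurable]: "first_hit B T m k \<in> sets M" by (rule sets_first_hit) (use T in simp_all)
  have t: "?t \<ge> 0" by (rule grid_nonneg[OF T])
  define g :: "(nat \<Rightarrow> 'a) \<Rightarrow> ennreal" where
    "g = indicator {r \<in> space (PiM {..k} (\<lambda>_. borel)). r k \<in> B \<and> (\<forall>j\<in>{1..<k}. r j \<notin> B)}"
  have g: "g \<in> borel_measurable (PiM {..k} (\<lambda>_. borel))"
    unfolding g_def by measurable
  have gX: "g (\<lambda>i\<in>{..k}. X (grid T m i) \<omega>) = indicator (first_hit B T m k) \<omega>" if "\<omega> \<in> space M" for \<omega>
    using that by (auto simp: g_def first_hit_def space_PiM indicator_def)
  have markov: "(\<integral>\<^sup>+\<omega>. indicator (first_hit B T m k) \<omega> * indicator K (X (?t + u) \<omega>) \<partial>M) =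
      (\<integral>\<^sup>+\<omega>. indicator (first_hit B T m k) \<omega> * transition M X u (indicator K) (X ?t \<omega>) \<partial>M)"
    if "u \<ge> 0" for u
  proof -
    have "(\<integral>\<^sup>+\<omega>. indicator (first_hit B T m k) \<omega> * indicator K (X (?t + u) \<omega>) \<partial>M) =
      (\<integral>\<^sup>+\<omega>. g (\<lambda>i\<in>{..k}. X (grid T m i) \<omega>) * indicator K (X (?t + u) \<omega>) \<partial>M)"
      by (intro nn_integral_cong) (simp add: gX)
    also have "\<dots> = (\<integral>\<^sup>+\<omega>. g (\<lambda>i\<in>{..k}. X (grid T m i) \<omega>) * transition M X u (indicator K) (X ?t \<omega>) \<partial>M)"
      by (rule markov_property[OF _ mono_grid[OF T] that g]) (simp_all add: grid_def)
    also have "\<dots> = (\<integral>\<^sup>+\<omega>. indicator (first_hit B T m k) \<omega> * transition M X u (indicator K) (X ?t \<omega>) \<partial>M)"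
      by (intro nn_integral_cong) (simp add: gX)
    finally show ?thesis .
  qed
  have "(\<integral>\<^sup>+s. (\<integral>\<^sup>+\<omega>. indicator (first_hit B T m k) \<omega> * indicator K (X (max 0 s) \<omega>) \<partial>M) *
        indicator {?t..} s \<partial>lborel) =
      (\<integral>\<^sup>+u. (\<integral>\<^sup>+\<omega>. indicator (first_hit B T m k) \<omega> * indicator K (X (max 0 (?t + 1 * u)) \<omega>) \<partial>M) *
        indicator {?t..} (?t + 1 * u) \<partial>lborel)"
    by (subst nn_integral_real_affine[of _ 1 ?t]) simp_all
  also have "\<dots> = (\<integral>\<^sup>+u. (\<integral>\<^sup>+\<omega>. indicator (first_hit B T m k) \<omega> *
        (transition M X (max 0 u) (indicator K) (X (max 0 ?t) \<omega>) * indicator {0..} u) \<partial>M) \<partial>lborel)"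
  proof (intro nn_integral_cong)
    fix u :: real
    show "(\<integral>\<^sup>+\<omega>. indicator (first_hit B T m k) \<omega> * indicator K (X (max 0 (?t + 1 * u)) \<omega>) \<partial>M) *
        indicator {?t..} (?t + 1 * u) = (\<integral>\<^sup>+\<omega>. indicator (first_hit B T m k) \<omega> *
        (transition M X (max 0 u) (indicator K) (X (max 0 ?t) \<omega>) * indicator {0..} u) \<partial>M)"
      using t markov[of u] by (cases "u \<ge> 0") (simp_all add: max_absorb2)
  qed
  also have "\<dots> = (\<integral>\<^sup>+\<omega>. (\<integral>\<^sup>+u. indicator (first_hit B T m k) \<omega> *
        (transition M X (max 0 u) (indicator K) (X (max 0 ?t) \<omega>) * indicator {0..} u) \<partial>lborel) \<partial>M)"
  proof -
    interpret pair_sigma_finite lborel M ..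
    show ?thesis by (rule Fubini'[symmetric]) measurable
  qed
  also have "\<dots> = (\<integral>\<^sup>+\<omega>. indicator (first_hit B T m k) \<omega> * green M X (indicator K) (X ?t \<omega>) \<partial>M)"
    using t unfolding green_eq
    by (intro nn_integral_cong) (simp add: nn_integral_cmult max_absorb2)
  finally show ?thesis .
qed

text \<open>First visits are disjoint, so at most one summand is nonzero. Each summand is a product
  of a function of s and one of \<omega>, which gives joint measurability and lets the sum pass
  through the integrals.\<close>

lemma indicator_hit_by:
  assumes "T \<ge> 0"
  shows "indicator (hit_by B T m s) \<omega> =
    (\<Sum>k. indicator (first_hit B T m (Suc k)) \<omega> * indicator {grid T m (Suc k)..} s :: ennreal)"
proof -
  define A where "A k = {p. snd p \<in> first_hit B T m (Suc k) \<and> fst p \<in> {grid T m (Suc k)..}}" for k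
  have "disjoint_family A"
    using first_hit_disjoint[of B T m] by (fastforce simp: disjoint_family_on_def A_def)
  then have "(\<Sum>k. indicator (A k) (s, \<omega>) :: ennreal) = indicator (\<Union>k. A k) (s, \<omega>)"
    by (rule suminf_indicator)
  moreover have "indicator (A k) (s, \<omega>) =
      (indicator (first_hit B T m (Suc k)) \<omega> * indicator {grid T m (Suc k)..} s :: ennreal)" for k
    by (auto simp: A_def indicator_def)
  moreover have "indicator (\<Union>k. A k) (s, \<omega>) = (indicator (hit_by B T m s) \<omega> :: ennreal)"
    using hit_by_iff_first_hit[OF assms, of \<omega> B m s] by (auto simp: A_def indicator_def)
  ultimately show ?thesis by simp
qed

lemma measurable_hit_by [measurable (raw)]:
  assumes "open B" "T \<ge> 0"
    and [measurable]: "f \<in> borel_measurable L" "g \<in> L \<rightarrow>\<^sub>M M"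
  shows "(\<lambda>x. indicator (hit_by B T m (f x)) (g x) :: ennreal) \<in> borel_measurable L"
proof -
  have [measurable]: "first_hit B T m k \<in> sets M" for k
    using assms by (intro sets_first_hit) auto
  show ?thesis unfolding indicator_hit_by[OF \<open>T \<ge> 0\<close>] by measurable
qed

lemma occupation_after_grid_hit:
  assumes B: "open B" and K [measurable]: "K \<in> sets borel" and T: "T \<ge> 0"
  shows "(\<integral>\<^sup>+s. (\<integral>\<^sup>+\<omega>. indicator (hit_by B T m s) \<omega> * indicator K (X (max 0 s) \<omega>) \<partial>M) \<partial>lborel) =
    (\<Sum>k. \<integral>\<^sup>+\<omega>. indicator (first_hit B T m (Suc k)) \<omega> *
        green M X (indicator K) (X (grid T m (Suc k)) \<omega>) \<partial>M)"
proof -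
  have [measurable]: "first_hit B T m k \<in> sets M" for k
    using assms by (intro sets_first_hit) auto
  have "(\<integral>\<^sup>+s. (\<integral>\<^sup>+\<omega>. indicator (hit_by B T m s) \<omega> * indicator K (X (max 0 s) \<omega>) \<partial>M) \<partial>lborel) =
      (\<integral>\<^sup>+s. (\<integral>\<^sup>+\<omega>. (\<Sum>k. indicator (first_hit B T m (Suc k)) \<omega> * indicator K (X (max 0 s) \<omega>) *
        indicator {grid T m (Suc k)..} s) \<partial>M) \<partial>lborel)"
    unfolding indicator_hit_by[OF T] by (simp add: mult_ac flip: ennreal_suminf_multc)
  also have "\<dots> = (\<integral>\<^sup>+s. (\<Sum>k. \<integral>\<^sup>+\<omega>. indicator (first_hit B T m (Suc k)) \<omega> * indicator K (X (max 0 s) \<omega>) *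
        indicator {grid T m (Suc k)..} s \<partial>M) \<partial>lborel)"
    by (subst nn_integral_suminf) simp_all
  also have "\<dots> = (\<integral>\<^sup>+s. (\<Sum>k. (\<integral>\<^sup>+\<omega>. indicator (first_hit B T m (Suc k)) \<omega> * indicator K (X (max 0 s) \<omega>) \<partial>M) *
        indicator {grid T m (Suc k)..} s) \<partial>lborel)"
    by (simp add: nn_integral_multc)
  also have "\<dots> = (\<Sum>k. \<integral>\<^sup>+s. (\<integral>\<^sup>+\<omega>. indicator (first_hit B T m (Suc k)) \<omega> * indicator K (X (max 0 s) \<omega>) \<partial>M) *
        indicator {grid T m (Suc k)..} s \<partial>lborel)"
    by (subst nn_integral_suminf) simp_all
  finally show ?thesis by (simp add: occupation_after_first_hit[OF B K T])
qed

lemma suminf_first_hit: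
  assumes "open B" "T \<ge> 0"
  shows "(\<Sum>k. \<integral>\<^sup>+\<omega>. indicator (first_hit B T m (Suc k)) \<omega> * c \<partial>M) =
    c * emeasure M (\<Union>k. first_hit B T m (Suc k))"
proof -
  have [measurable]: "first_hit B T m k \<in> sets M" for k
    using assms by (intro sets_first_hit) auto
  have "(\<Sum>k. \<integral>\<^sup>+\<omega>. indicator (first_hit B T m (Suc k)) \<omega> * c \<partial>M) =
      (\<Sum>k. c * emeasure M (first_hit B T m (Suc k)))"
    by (simp add: mult.commute nn_integral_cmult_indicator)
  also have "\<dots> = c * (\<Sum>k. emeasure M (first_hit B T m (Suc k)))" by simp
  also have "(\<Sum>k. emeasure M (first_hit B T m (Suc k))) = emeasure M (\<Union>k. first_hit B T m (Suc k))"
    by (intro suminf_emeasure first_hit_disjoint) auto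
  finally show ?thesis .
qed

text \<open>Grid visits happen strictly after T, so the occupation of K after the first of them is
  part of the occupation after T; its mean is at least c on each first-visit event. Continuity of
  the measure from below removes the grid.\<close>

lemma hit_after_le_occupation:
  assumes B: "open B" and K [measurable]: "K \<in> sets borel" and T: "T \<ge> 0"
    and c: "\<And>x. x \<in> B \<Longrightarrow> c \<le> green M X (indicator K) x"
  shows "c * emeasure M (hit_after B T) \<le>
    (\<integral>\<^sup>+s. transition M X (max 0 s) (indicator K) 0 * indicator {T<..} s \<partial>lborel)" (is "_ \<le> ?I")
proof -
  have [measurable]: "first_hit B T m k \<in> sets M" for m k
    using assms by (intro sets_first_hit) auto
  have le: "c * emeasure M (\<Union>k. first_hit B T m (Suc k)) \<le> ?I" for m
  proof -
    have "c * emeasure M (\<Union>k. first_hit B T m (Suc k)) =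
        (\<Sum>k. \<integral>\<^sup>+\<omega>. indicator (first_hit B T m (Suc k)) \<omega> * c \<partial>M)"
      using suminf_first_hit[OF B T] by simp
    also have "\<dots> \<le> (\<Sum>k. \<integral>\<^sup>+\<omega>. indicator (first_hit B T m (Suc k)) \<omega> *
        green M X (indicator K) (X (grid T m (Suc k)) \<omega>) \<partial>M)"
      by (intro suminf_le nn_integral_mono) (auto simp: first_hit_def indicator_def intro!: c)
    also have "\<dots> = (\<integral>\<^sup>+s. (\<integral>\<^sup>+\<omega>. indicator (hit_by B T m s) \<omega> * indicator K (X (max 0 s) \<omega>) \<partial>M) \<partial>lborel)"
      by (rule occupation_after_grid_hit[OF B K T, symmetric])
    also have "\<dots> \<le> ?I"
    proof (intro nn_integral_mono)
      fix s :: real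
      show "(\<integral>\<^sup>+\<omega>. indicator (hit_by B T m s) \<omega> * indicator K (X (max 0 s) \<omega>) \<partial>M) \<le>
          transition M X (max 0 s) (indicator K) 0 * indicator {T<..} s"
      proof (cases "s > T")
        case True
        then show ?thesis
          by (auto simp: transition_def indicator_def intro!: nn_integral_mono)
      next
        case False
        then have "hit_by B T m s = {}"
          using grid_gt[of T m] by (auto simp: hit_by_def) (meson le_less_trans less_le_trans)
        then show ?thesis by simp
      qed
    qed
    finally show ?thesis .
  qed
  have "emeasure M (hit_after B T) = (SUP m. emeasure M (\<Union>k. first_hit B T m (Suc k)))"
    unfolding hit_after_eq[OF T B] using incseq_grid_hit[OF T]
    by (intro SUP_emeasure_incseq[symmetric]) auto
  then have "c * emeasure M (hit_after B T) = (SUP m. c * emeasure M (\<Union>k. first_hit B T m (Suc k)))"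
    by (simp add: SUP_mult_left_ennreal)
  also have "\<dots> \<le> ?I" using le by (rule SUP_least)
  finally show ?thesis .
qed

text \<open>Time spent in B after T is spent after the first visit to B, so with the same set in
  both roles no occupation is lost. Here the mesh must vanish inside the time integral, by monotone
  convergence.\<close>

lemma occupation_le_hit_after:
  assumes B: "open B" and T: "T \<ge> 0"
    and C: "\<And>x. x \<in> B \<Longrightarrow> green M X (indicator B) x \<le> C"
  shows "(\<integral>\<^sup>+s. transition M X (max 0 s) (indicator B) 0 * indicator {T<..} s \<partial>lborel) \<le>
    C * emeasure M (hit_after B T)"
proof -
  have B' [measurable]: "B \<in> sets borel" using B by simp
  have [measurable]: "first_hit B T m k \<in> sets M" for m k
    using assms by (intro sets_first_hit) auto
  note [measurable] = measurable_hit_by[OF B T]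
  interpret pair_sigma_finite lborel M ..
  define f where "f m s \<omega> = (indicator (hit_by B T m s) \<omega> * indicator B (X (max 0 s) \<omega>) :: ennreal)"
    for m s \<omega>
  have f [measurable]: "(\<lambda>p. f m (fst p) (snd p)) \<in> borel_measurable (lborel \<Otimes>\<^sub>M M)"
    "(\<lambda>p. f m (snd p) (fst p)) \<in> borel_measurable (M \<Otimes>\<^sub>M lborel)"
    "\<omega> \<in> space M \<Longrightarrow> (\<lambda>s. f m s \<omega>) \<in> borel_measurable lborel" for m \<omega>
    unfolding f_def by measurable
  have fmono: "f m s \<omega> \<le> f (Suc m) s \<omega>" for m s \<omega>
    using hit_by_mono[of B T m s] by (auto simp: f_def indicator_def)
  have le: "(\<integral>\<^sup>+\<omega>. \<integral>\<^sup>+s. f m s \<omega> \<partial>lborel \<partial>M) \<le> C * emeasure M (hit_after B T)" for m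
  proof -
    have "(\<integral>\<^sup>+\<omega>. \<integral>\<^sup>+s. f m s \<omega> \<partial>lborel \<partial>M) = (\<integral>\<^sup>+s. \<integral>\<^sup>+\<omega>. f m s \<omega> \<partial>M \<partial>lborel)"
      by (rule Fubini') (use f(1)[of m] in \<open>simp add: case_prod_beta'\<close>)
    also have "\<dots> = (\<Sum>k. \<integral>\<^sup>+\<omega>. indicator (first_hit B T m (Suc k)) \<omega> *
        green M X (indicator B) (X (grid T m (Suc k)) \<omega>) \<partial>M)"
      unfolding f_def by (rule occupation_after_grid_hit[OF B B' T])
    also have "\<dots> \<le> (\<Sum>k. \<integral>\<^sup>+\<omega>. indicator (first_hit B T m (Suc k)) \<omega> * C \<partial>M)"
      by (intro suminf_le nn_integral_mono) (auto simp: first_hit_def indicator_def intro!: C)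
    also have "\<dots> = C * emeasure M (\<Union>k. first_hit B T m (Suc k))"
      by (rule suminf_first_hit[OF B T])
    also have "\<dots> \<le> C * emeasure M (hit_after B T)"
      using sets_hit_after[OF T B]
      by (intro mult_left_mono emeasure_mono) (auto simp: hit_after_eq[OF T B])
    finally show ?thesis .
  qed
  have "(\<integral>\<^sup>+s. transition M X (max 0 s) (indicator B) 0 * indicator {T<..} s \<partial>lborel) =
      (\<integral>\<^sup>+s. \<integral>\<^sup>+\<omega>. indicator B (X (max 0 s) \<omega>) * indicator {T<..} s \<partial>M \<partial>lborel)"
    by (simp add: transition_def nn_integral_multc)
  \<comment> \<open>Time becomes the inner variable because the exceptional null set of times
    depends on \<omega>.\<close>
  also have "\<dots> = (\<integral>\<^sup>+\<omega>. \<integral>\<^sup>+s. indicator B (X (max 0 s) \<omega>) * indicator {T<..} s \<partial>lborel \<partial>M)"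
    by (rule Fubini'[symmetric]) measurable
  also have "\<dots> \<le> (\<integral>\<^sup>+\<omega>. \<integral>\<^sup>+s. (SUP m. f m s \<omega>) \<partial>lborel \<partial>M)"
  proof (rule nn_integral_mono)
    fix \<omega> assume \<omega>: "\<omega> \<in> space M"
    \<comment> \<open>Only the infimum of the hitting times after \<open>T\<close> can be missed by all dyadic grids.\<close>
    define N where "N = {s. s > T \<and> X s \<omega> \<in> B \<and> (\<forall>m. \<omega> \<notin> hit_by B T m s)}"
    have "\<not> s < s'" if "s \<in> N" "s' \<in> N" for s s'
      using that hit_by_of_hit[OF \<omega> T _ _ B, of s s'] by (auto simp: N_def)
    then have "s = s'" if "s \<in> N" "s' \<in> N" for s s' using that by (meson linorder_neqE)
    then obtain a where a: "N \<subseteq> {a}" by blast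
    have "AE s in lborel. s \<noteq> a" by (rule AE_lborel_singleton)
    then have "AE s in lborel. indicator B (X (max 0 s) \<omega>) * indicator {T<..} s \<le> (SUP m. f m s \<omega>)"
    proof eventually_elim
      case (elim s)
      show ?case
      proof (cases "s > T \<and> X s \<omega> \<in> B")
        case True
        with elim a obtain m where "\<omega> \<in> hit_by B T m s" by (auto simp: N_def)
        with True T have "f m s \<omega> = 1" by (simp add: f_def max_absorb2)
        then have "1 \<le> (SUP m. f m s \<omega>)" by (metis SUP_upper UNIV_I)
        then show ?thesis by (auto simp: indicator_def)
      next
        case False
        with T show ?thesis by (auto simp: indicator_def max_absorb2)
      qed
    qed
    then show "(\<integral>\<^sup>+s. indicator B (X (max 0 s) \<omega>) * indicator {T<..} s \<partial>lborel) \<le>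
        (\<integral>\<^sup>+s. (SUP m. f m s \<omega>) \<partial>lborel)"
      by (rule nn_integral_mono_AE)
  qed
  also have "\<dots> = (\<integral>\<^sup>+\<omega>. (SUP m. \<integral>\<^sup>+s. f m s \<omega> \<partial>lborel) \<partial>M)"
    using fmono by (intro nn_integral_cong nn_integral_monotone_convergence_SUP incseq_SucI le_funI f(3))
  also have "\<dots> = (SUP m. \<integral>\<^sup>+\<omega>. \<integral>\<^sup>+s. f m s \<omega> \<partial>lborel \<partial>M)"
    using fmono by (intro nn_integral_monotone_convergence_SUP incseq_SucI le_funI nn_integral_mono) auto
  also have "\<dots> \<le> C * emeasure M (hit_after B T)"
    using le by (rule SUP_least)
  finally show ?thesis .
qed

end

section \<open>Moments of the last exit time\<close>

text \<open>The layer-cake formula: the power is the integral of its derivative over [0, a). The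
  strict bound t < a is chosen to match the event that the last exit time exceeds t.\<close>

lemma ennreal_powr_eq_nn_integral:
  assumes \<zeta>: "\<zeta> > 0"
  shows "ennreal_powr a \<zeta> =
    (\<integral>\<^sup>+t. ennreal (\<zeta> * t powr (\<zeta> - 1)) * indicator {t. 0 \<le> t \<and> ennreal t < a} t \<partial>lborel)"
proof -
  let ?f = "\<lambda>t. ennreal (\<zeta> * t powr (\<zeta> - 1))"
  have fin: "(\<integral>\<^sup>+t. ?f t * indicator {t. 0 \<le> t \<and> ennreal t < ennreal b} t \<partial>lborel) = ennreal (b powr \<zeta>)"
    if b: "b \<ge> 0" for b
  proof -
    have "((\<lambda>t. t powr (\<zeta> - 1)) has_integral (b powr (\<zeta> - 1 + 1) / (\<zeta> - 1 + 1))) {0..b}"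
      by (rule has_integral_powr_from_0) (use \<zeta> b in auto)
    then have "((\<lambda>t. \<zeta> * t powr (\<zeta> - 1)) has_integral b powr \<zeta>) {0..b}"
      using has_integral_mult_right[of "\<lambda>t. t powr (\<zeta> - 1)" _ "{0..b}" \<zeta>] \<zeta> by fastforce
    then have "(\<integral>\<^sup>+t. ennreal (indicator {0..b} t * (\<zeta> * t powr (\<zeta> - 1))) \<partial>lborel) = ennreal (b powr \<zeta>)"
      using \<zeta> by (intro nn_integral_has_integral_lebesgue) auto
    moreover have "(\<integral>\<^sup>+t. ?f t * indicator {t. 0 \<le> t \<and> ennreal t < ennreal b} t \<partial>lborel) =
        (\<integral>\<^sup>+t. ennreal (indicator {0..b} t * (\<zeta> * t powr (\<zeta> - 1))) \<partial>lborel)"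
      \<comment> \<open>The two integrands differ at most at the endpoint b.\<close>
      using AE_lborel_singleton[of b]
      by (intro nn_integral_cong_AE) (auto elim!: eventually_mono simp: indicator_def ennreal_less_iff)
    ultimately show ?thesis by simp
  qed
  show ?thesis
  proof (cases a)
    case (real b)
    with \<zeta> show ?thesis by (simp add: ennreal_powr_def fin)
  next
    case top
    have "ennreal (real n) \<le> (\<integral>\<^sup>+t. ?f t * indicator {t. 0 \<le> t \<and> ennreal t < a} t \<partial>lborel)" for n
    proof -
      \<comment> \<open>The upper limit n^(1/\<zeta>) is the one for which the finite case yields
        n.\<close>
      have "ennreal (real n) = (\<integral>\<^sup>+t. ?f t * indicator {t. 0 \<le> t \<and> ennreal t < ennreal (real n powr (1 / \<zeta>))} t \<partial>lborel)"
        using \<zeta> by (subst fin) (simp_all add: powr_powr)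
      also have "\<dots> \<le> (\<integral>\<^sup>+t. ?f t * indicator {t. 0 \<le> t \<and> ennreal t < a} t \<partial>lborel)"
        by (intro nn_integral_mono) (auto simp: top indicator_def)
      finally show ?thesis .
    qed
    then have "(\<integral>\<^sup>+t. ?f t * indicator {t. 0 \<le> t \<and> ennreal t < a} t \<partial>lborel) = \<top>"
      using ennreal_Ex_less_of_nat by (metis ennreal_of_nat_eq_real_of_nat leD top.not_eq_extremum)
    with \<zeta> top show ?thesis by (simp add: ennreal_powr_def)
  qed
qed

context regular_levy_process
begin

definition occupation_moment :: "real \<Rightarrow> 'a set \<Rightarrow> ennreal" where
  "occupation_moment \<zeta> K = (\<integral>\<^sup>+s. ennreal (s powr \<zeta>) *
     (transition M X (max 0 s) (indicator K) 0 * indicator {0..} s) \<partial>lborel)"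

lemma last_exit_gt_iff:
  "T \<ge> 0 \<Longrightarrow> \<omega> \<in> space M \<Longrightarrow> ennreal T < last_exit X B \<omega> \<longleftrightarrow> \<omega> \<in> hit_after B T"
proof -
  assume T: "T \<ge> 0" "\<omega> \<in> space M"
  have "ennreal T < last_exit X B \<omega> \<longleftrightarrow> (\<exists>t\<ge>0. X t \<omega> \<in> B \<and> ennreal T < ennreal t)"
    unfolding last_exit_def less_Sup_iff by blast
  also have "\<dots> \<longleftrightarrow> (\<exists>t>T. X t \<omega> \<in> B)"
    using T(1) by (simp add: ennreal_less_iff) (meson le_less_trans less_imp_le)
  finally show ?thesis using T(2) by (simp add: hit_after_def)
qed

lemma measurable_last_exit [measurable]:
  assumes "open B"
  shows "last_exit X B \<in> borel_measurable M"
proof (rule borel_measurableI_greater)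
  fix y :: ennreal
  show "{\<omega> \<in> space M. y < last_exit X B \<omega>} \<in> sets M"
  proof (cases y)
    case (real T)
    then have "{\<omega> \<in> space M. y < last_exit X B \<omega>} = hit_after B T"
      using last_exit_gt_iff[of T] by (auto simp: hit_after_def)
    with sets_hit_after real assms show ?thesis by simp
  qed simp
qed

text \<open>The measure is the integral over \<omega> of the indicator of a jointly measurable set
  of pairs. Negative t are cut off because \<open>X\<close> is unconstrained at negative
  times.\<close>

lemma measurable_emeasure_hit_after:
  assumes B: "open B"
  shows "(\<lambda>t. emeasure M (hit_after B t) * indicator {0..} t) \<in> borel_measurable borel"
proof -
  note [measurable] = measurable_last_exit[OF B]
  have "emeasure M (hit_after B t) * indicator {0..} t =
      (\<integral>\<^sup>+\<omega>. indicator {p. 0 \<le> fst p \<and> ennreal (fst p) < last_exit X B (snd p)} (t, \<omega>) \<partial>M)" for t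
  proof (cases "t \<ge> 0")
    case True
    then have "(\<integral>\<^sup>+\<omega>. indicator {p. 0 \<le> fst p \<and> ennreal (fst p) < last_exit X B (snd p)} (t, \<omega>) \<partial>M) =
        (\<integral>\<^sup>+\<omega>. indicator (hit_after B t) \<omega> \<partial>M)"
      by (intro nn_integral_cong) (simp add: indicator_def last_exit_gt_iff)
    with True sets_hit_after[OF True B] show ?thesis by simp
  qed (simp add: indicator_def)
  then show ?thesis by simp
qed

lemma last_exit_moment:
  assumes B: "open B" and \<zeta>: "\<zeta> > 0"
  shows "(\<integral>\<^sup>+\<omega>. ennreal_powr (last_exit X B \<omega>) \<zeta> \<partial>M) =
    (\<integral>\<^sup>+t. ennreal (\<zeta> * t powr (\<zeta> - 1)) * (emeasure M (hit_after B t) * indicator {0..} t) \<partial>lborel)"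
proof -
  interpret pair_sigma_finite lborel M ..
  note [measurable] = measurable_last_exit[OF B]
  have "(\<integral>\<^sup>+\<omega>. ennreal_powr (last_exit X B \<omega>) \<zeta> \<partial>M) =
    (\<integral>\<^sup>+\<omega>. \<integral>\<^sup>+t. ennreal (\<zeta> * t powr (\<zeta> - 1)) *
      indicator {p. 0 \<le> fst p \<and> ennreal (fst p) < last_exit X B (snd p)} (t, \<omega>) \<partial>lborel \<partial>M)"
    by (simp add: ennreal_powr_eq_nn_integral[OF \<zeta>] indicator_def)
  also have "\<dots> = (\<integral>\<^sup>+t. \<integral>\<^sup>+\<omega>. ennreal (\<zeta> * t powr (\<zeta> - 1)) *
      indicator {p. 0 \<le> fst p \<and> ennreal (fst p) < last_exit X B (snd p)} (t, \<omega>) \<partial>M \<partial>lborel)"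
    by (rule Fubini') measurable
  also have "\<dots> = (\<integral>\<^sup>+t. ennreal (\<zeta> * t powr (\<zeta> - 1)) * (emeasure M (hit_after B t) * indicator {0..} t) \<partial>lborel)"
  proof (intro nn_integral_cong)
    fix t :: real
    show "(\<integral>\<^sup>+\<omega>. ennreal (\<zeta> * t powr (\<zeta> - 1)) *
        indicator {p. 0 \<le> fst p \<and> ennreal (fst p) < last_exit X B (snd p)} (t, \<omega>) \<partial>M) =
      ennreal (\<zeta> * t powr (\<zeta> - 1)) * (emeasure M (hit_after B t) * indicator {0..} t)"
    proof (cases "t \<ge> 0")
      case True
      then have "(\<integral>\<^sup>+\<omega>. ennreal (\<zeta> * t powr (\<zeta> - 1)) *
        indicator {p. 0 \<le> fst p \<and> ennreal (fst p) < last_exit X B (snd p)} (t, \<omega>) \<partial>M) =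
        (\<integral>\<^sup>+\<omega>. ennreal (\<zeta> * t powr (\<zeta> - 1)) * indicator (hit_after B t) \<omega> \<partial>M)"
        by (intro nn_integral_cong) (simp add: indicator_def last_exit_gt_iff)
      with True sets_hit_after[OF True B] show ?thesis by (simp add: nn_integral_cmult_indicator)
    qed (simp add: indicator_def)
  qed
  finally show ?thesis .
qed

text \<open>Applying the layer-cake formula to s^\<zeta> brings this moment into the shape of
  \<open>last_exit_moment\<close>, so the bounds at fixed T can be compared under the integral
  sign.\<close>

lemma occupation_moment_eq:
  assumes [measurable]: "K \<in> sets borel" and \<zeta>: "\<zeta> > 0"
  shows "occupation_moment \<zeta> K = (\<integral>\<^sup>+t. ennreal (\<zeta> * t powr (\<zeta> - 1)) *
    ((\<integral>\<^sup>+s. transition M X (max 0 s) (indicator K) 0 * indicator {t<..} s \<partial>lborel) * indicator {0..} t) \<partial>lborel)"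
proof -
  let ?p = "\<lambda>s. transition M X (max 0 s) (indicator K) 0"
  have "occupation_moment \<zeta> K = (\<integral>\<^sup>+s. (\<integral>\<^sup>+t. ennreal (\<zeta> * t powr (\<zeta> - 1)) *
      indicator {t. 0 \<le> t \<and> ennreal t < ennreal s} t \<partial>lborel) * (?p s * indicator {0..} s) \<partial>lborel)"
    unfolding occupation_moment_def ennreal_powr_eq_nn_integral[OF \<zeta>, symmetric]
    using \<zeta> by (intro nn_integral_cong) (auto simp: ennreal_powr_def indicator_def)
  also have "\<dots> = (\<integral>\<^sup>+s. (\<integral>\<^sup>+t. ennreal (\<zeta> * t powr (\<zeta> - 1)) *
      (?p s * indicator {p. fst p < snd p \<and> fst p \<ge> 0} (t, s)) \<partial>lborel) \<partial>lborel)"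
    by (subst nn_integral_multc[symmetric], measurable, intro nn_integral_cong)
      (auto simp: indicator_def ennreal_less_iff)
  also have "\<dots> = (\<integral>\<^sup>+t. (\<integral>\<^sup>+s. ennreal (\<zeta> * t powr (\<zeta> - 1)) *
      (?p s * indicator {p. fst p < snd p \<and> fst p \<ge> 0} (t, s)) \<partial>lborel) \<partial>lborel)"
    by (rule lborel_pair.Fubini') measurable
  also have "\<dots> = (\<integral>\<^sup>+t. ennreal (\<zeta> * t powr (\<zeta> - 1)) *
      (\<integral>\<^sup>+s. ?p s * indicator {p. fst p < snd p \<and> fst p \<ge> 0} (t, s) \<partial>lborel) \<partial>lborel)"
    by (intro nn_integral_cong nn_integral_cmult) measurable
  also have "\<dots> = (\<integral>\<^sup>+t. ennreal (\<zeta> * t powr (\<zeta> - 1)) *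
    ((\<integral>\<^sup>+s. ?p s * indicator {t<..} s \<partial>lborel) * indicator {0..} t) \<partial>lborel)"
    by (intro nn_integral_cong arg_cong2[where f = "(*)"] refl) (simp add: indicator_def)
  finally show ?thesis .
qed

lemma last_exit_moment_le:
  assumes B: "open B" and K: "K \<in> sets borel" and \<zeta>: "\<zeta> > 0"
    and c: "\<And>x. x \<in> B \<Longrightarrow> c \<le> green M X (indicator K) x"
  shows "c * (\<integral>\<^sup>+\<omega>. ennreal_powr (last_exit X B \<omega>) \<zeta> \<partial>M) \<le> occupation_moment \<zeta> K"
proof -
  note [measurable] = measurable_emeasure_hit_after[OF B]
  have "c * (\<integral>\<^sup>+\<omega>. ennreal_powr (last_exit X B \<omega>) \<zeta> \<partial>M) = (\<integral>\<^sup>+t. ennreal (\<zeta> * t powr (\<zeta> - 1)) *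
      (c * emeasure M (hit_after B t) * indicator {0..} t) \<partial>lborel)"
    unfolding last_exit_moment[OF B \<zeta>]
    by (subst nn_integral_cmult[symmetric], measurable, intro nn_integral_cong) (simp add: mult_ac)
  also have "\<dots> \<le> occupation_moment \<zeta> K"
    unfolding occupation_moment_eq[OF K \<zeta>]
    using hit_after_le_occupation[OF B K _ c]
    by (intro nn_integral_mono mult_left_mono) (auto simp: indicator_def)
  finally show ?thesis .
qed

lemma occupation_moment_le:
  assumes B: "open B" and \<zeta>: "\<zeta> > 0"
    and C: "\<And>x. x \<in> B \<Longrightarrow> green M X (indicator B) x \<le> C"
  shows "occupation_moment \<zeta> B \<le> C * (\<integral>\<^sup>+\<omega>. ennreal_powr (last_exit X B \<omega>) \<zeta> \<partial>M)"
proof -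
  note [measurable] = measurable_emeasure_hit_after[OF B]
  have "occupation_moment \<zeta> B \<le> (\<integral>\<^sup>+t. ennreal (\<zeta> * t powr (\<zeta> - 1)) *
      (C * emeasure M (hit_after B t) * indicator {0..} t) \<partial>lborel)"
    unfolding occupation_moment_eq[OF borel_open[OF B] \<zeta>]
    using occupation_le_hit_after[OF B _ C]
    by (intro nn_integral_mono mult_left_mono) (auto simp: indicator_def)
  also have "\<dots> = C * (\<integral>\<^sup>+\<omega>. ennreal_powr (last_exit X B \<omega>) \<zeta> \<partial>M)"
    unfolding last_exit_moment[OF B \<zeta>]
    by (subst nn_integral_cmult[symmetric], measurable, intro nn_integral_cong) (simp add: mult_ac)
  finally show ?thesis .
qed

end

section \<open>The degree of transience\<close>

text \<open>Once 0 lies in both sets, negative exponents are dominated by it, so agreement at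
  positive exponents settles the suprema.\<close>

lemma Sup_ereal_nonneg_eq:
  fixes P Q :: "real \<Rightarrow> bool"
  assumes "P 0" "Q 0" and PQ: "\<And>\<zeta>. \<zeta> > 0 \<Longrightarrow> P \<zeta> \<longleftrightarrow> Q \<zeta>"
  shows "Sup {ereal \<zeta> |\<zeta>. \<zeta> > -1 \<and> P \<zeta>} = Sup {ereal \<zeta> |\<zeta>. \<zeta> \<ge> 0 \<and> Q \<zeta>}"
proof (rule antisym)
  show "Sup {ereal \<zeta> |\<zeta>. \<zeta> > -1 \<and> P \<zeta>} \<le> Sup {ereal \<zeta> |\<zeta>. \<zeta> \<ge> 0 \<and> Q \<zeta>}"
  proof (rule Sup_least)
    fix x assume "x \<in> {ereal \<zeta> |\<zeta>. \<zeta> > -1 \<and> P \<zeta>}"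
    then obtain \<zeta> where \<zeta>: "x = ereal \<zeta>" "P \<zeta>" by auto
    have "Q (max 0 \<zeta>)" using assms \<zeta>(2) by (cases "\<zeta> > 0") (auto simp: max_def)
    then have "ereal (max 0 \<zeta>) \<le> Sup {ereal \<zeta> |\<zeta>. \<zeta> \<ge> 0 \<and> Q \<zeta>}"
      by (intro Sup_upper CollectI exI[of _ "max 0 \<zeta>"]) simp
    then show "x \<le> Sup {ereal \<zeta> |\<zeta>. \<zeta> \<ge> 0 \<and> Q \<zeta>}"
      using \<zeta>(1) by (simp add: ereal_max)
  qed
  have "P \<zeta>" if "\<zeta> \<ge> 0" "Q \<zeta>" for \<zeta>
    using assms that by (cases "\<zeta> = 0") auto
  then show "Sup {ereal \<zeta> |\<zeta>. \<zeta> \<ge> 0 \<and> Q \<zeta>} \<le> Sup {ereal \<zeta> |\<zeta>. \<zeta> > -1 \<and> P \<zeta>}"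
    by (intro Sup_subset_mono) fastforce
qed

context regular_levy_process
begin

lemma green_power_indicator:
  "green_power M X (\<zeta> + 1) (indicator K) 0 = ennreal (1 / Gamma (\<zeta> + 1)) * occupation_moment \<zeta> K"
proof -
  have "ennreal (t powr (\<zeta> + 1 - 1)) * transition M X t (indicator K) 0 * indicator {0..} t =
      ennreal (t powr \<zeta>) * (transition M X (max 0 t) (indicator K) 0 * indicator {0..} t)" for t
    by (cases "t \<ge> 0") (simp_all add: max_absorb2 mult.assoc)
  then show ?thesis unfolding green_power_def occupation_moment_def by (simp only:)
qed

text \<open>The starting point is absorbed into K: when \<phi> (x + X t) is nonzero, X t = (x + X t)
  - x lies in K. Only the process from 0 remains.\<close>

lemma green_power_le:
  assumes [measurable]: "K \<in> sets borel" and \<phi>: "\<And>y. \<phi> y \<le> b" "\<And>y. \<phi> y \<noteq> 0 \<Longrightarrow> y - x \<in> K"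
  shows "green_power M X (\<zeta> + 1) \<phi> x \<le>
    b * (ennreal (1 / Gamma (\<zeta> + 1)) * occupation_moment \<zeta> K)"
proof -
  have le: "transition M X t \<phi> x \<le> b * transition M X t (indicator K) 0" if "t \<ge> 0" for t
  proof -
    have [measurable]: "X t \<in> borel_measurable M" by (rule measurable_X[OF that])
    have "transition M X t \<phi> x \<le> (\<integral>\<^sup>+\<omega>. b * indicator K (X t \<omega>) \<partial>M)"
      unfolding transition_def
    proof (rule nn_integral_mono)
      fix \<omega>
      show "\<phi> (x + X t \<omega>) \<le> b * indicator K (X t \<omega>)"
        using \<phi>(1)[of "x + X t \<omega>"] \<phi>(2)[of "x + X t \<omega>"]
        by (cases "\<phi> (x + X t \<omega>) = 0") (auto simp: indicator_def)
    qed
    also have "\<dots> = b * transition M X t (indicator K) 0"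
      unfolding transition_def by (subst nn_integral_cmult) simp_all
    finally show ?thesis .
  qed
  have "(\<integral>\<^sup>+t\<in>{0..}. ennreal (t powr (\<zeta> + 1 - 1)) * transition M X t \<phi> x \<partial>lborel) \<le>
      (\<integral>\<^sup>+t. b * (ennreal (t powr \<zeta>) *
        (transition M X (max 0 t) (indicator K) 0 * indicator {0..} t)) \<partial>lborel)"
  proof (rule nn_integral_mono)
    fix t :: real
    show "ennreal (t powr (\<zeta> + 1 - 1)) * transition M X t \<phi> x * indicator {0..} t \<le>
      b * (ennreal (t powr \<zeta>) * (transition M X (max 0 t) (indicator K) 0 * indicator {0..} t))"
      using mult_left_mono[OF le[of t], of "ennreal (t powr \<zeta>)"]
      by (cases "t \<ge> 0") (simp_all add: max_absorb2 mult_ac)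
  qed
  also have "\<dots> = b * occupation_moment \<zeta> K"
    unfolding occupation_moment_def by (rule nn_integral_cmult) measurable
  finally show ?thesis
    unfolding green_power_def mult.left_commute[of b] by (rule mult_left_mono) simp
qed

text \<open>\<open>\<K>\<close> is a family cofinal among the bounded sets up to translation: balls
  around 0 in part (i), finite sets in part (ii). Indicators of its members are test functions, and
  every test function is dominated by a multiple of a translate of one of them.\<close>

lemma green_power_finite_iff:
  assumes \<zeta>: "\<zeta> > -1"
    and \<K>: "\<And>K. K \<in> \<K> \<Longrightarrow> K \<in> sets borel \<and> bdd K"
    and cover: "\<And>A x. bdd A \<Longrightarrow> \<exists>K\<in>\<K>. \<forall>y\<in>A. y - x \<in> K"
  shows "(\<forall>\<phi> :: 'a \<Rightarrow> real. \<phi> \<in> borel_measurable borel \<and> (\<forall>x. \<phi> x \<ge> 0) \<and>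
          bounded (range \<phi>) \<and> bdd {x. \<phi> x \<noteq> 0} \<longrightarrow>
          (\<forall>x. green_power M X (\<zeta> + 1) (\<lambda>y. ennreal (\<phi> y)) x < \<infinity>)) \<longleftrightarrow>
    (\<forall>K\<in>\<K>. occupation_moment \<zeta> K < \<infinity>)" (is "?L \<longleftrightarrow> ?R")
proof
  assume L: ?L
  show ?R
  proof
    fix K assume K: "K \<in> \<K>"
    then have "indicat_real K \<in> borel_measurable borel"
      using \<K>[OF K] by (intro borel_measurable_indicator) simp
    moreover have "bounded (range (indicat_real K))"
      by (rule bounded_subset[of "{0, 1}"]) (auto simp: indicator_def)
    moreover have "{x. indicat_real K x \<noteq> 0} = K" by (auto simp: indicator_def)
    ultimately have "green_power M X (\<zeta> + 1) (\<lambda>y. ennreal (indicat_real K y)) 0 < \<infinity>"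
      using L \<K>[OF K] by simp
    \<comment> \<open>The factor 1 / Gamma must be nonzero for finiteness of the product to pass to
      the moment.\<close>
    moreover have "Gamma (\<zeta> + 1) > 0" using \<zeta> by (intro Gamma_real_pos) simp
    ultimately show "occupation_moment \<zeta> K < \<infinity>"
      by (auto simp: ennreal_indicator green_power_indicator ennreal_mult_less_top)
  qed
next
  assume R: ?R
  show ?L
  proof (intro allI impI, elim conjE)
    fix \<phi> :: "'a \<Rightarrow> real" and x
    assume \<phi>: "bounded (range \<phi>)" "bdd {x. \<phi> x \<noteq> 0}"
    obtain K where K: "K \<in> \<K>" "\<And>y. \<phi> y \<noteq> 0 \<Longrightarrow> y - x \<in> K"
      using cover[OF \<phi>(2), of x] by auto
    obtain b where b: "\<And>y. \<bar>\<phi> y\<bar> \<le> b" using \<phi>(1) by (auto simp: bounded_iff)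
    have "ennreal (\<phi> y) \<le> ennreal b" for y
      using b[of y] by (intro ennreal_leI) linarith
    moreover have "y - x \<in> K" if "ennreal (\<phi> y) \<noteq> 0" for y
      using that K(2)[of y] by (metis ennreal_0)
    ultimately have "green_power M X (\<zeta> + 1) (\<lambda>y. ennreal (\<phi> y)) x \<le>
        ennreal b * (ennreal (1 / Gamma (\<zeta> + 1)) * occupation_moment \<zeta> K)"
      using \<K>[OF K(1)] by (intro green_power_le) simp_all
    also have "\<dots> < \<infinity>" using R K(1) by (auto simp: ennreal_mult_less_top)
    finally show "green_power M X (\<zeta> + 1) (\<lambda>y. ennreal (\<phi> y)) x < \<infinity>" .
  qed
qed

lemma degree_of_transience_eq:
  assumes "\<And>K. K \<in> \<K> \<Longrightarrow> K \<in> sets borel \<and> bdd K"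
    and "\<And>A x. bdd A \<Longrightarrow> \<exists>K\<in>\<K>. \<forall>y\<in>A. y - x \<in> K"
  shows "degree_of_transience bdd M X =
    Sup {ereal \<zeta> |\<zeta>. \<zeta> > -1 \<and> (\<forall>K\<in>\<K>. occupation_moment \<zeta> K < \<infinity>)}"
  unfolding degree_of_transience_def using green_power_finite_iff[OF _ assms]
  by (intro arg_cong[where f = Sup] Collect_cong ex_cong1 conj_cong refl)

text \<open>\<open>0 powr 0\<close> is 0, so the integrands may differ at time 0; an inequality
  avoids discussing that point.\<close>

lemma occupation_moment_0_le: "occupation_moment 0 K \<le> green M X (indicator K) 0"
  unfolding occupation_moment_def green_eq by (intro nn_integral_mono) (auto simp: indicator_def)

lemma occupation_moment_mono: "K \<subseteq> L \<Longrightarrow> occupation_moment \<zeta> K \<le> occupation_moment \<zeta> L"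
  unfolding occupation_moment_def transition_def
  by (intro nn_integral_mono mult_left_mono mult_right_mono) (auto simp: indicator_def)

lemma occupation_moment_Un_le:
  assumes [measurable]: "K \<in> sets borel" "L \<in> sets borel"
  shows "occupation_moment \<zeta> (K \<union> L) \<le> occupation_moment \<zeta> K + occupation_moment \<zeta> L"
proof -
  have le: "transition M X (max 0 t) (indicator (K \<union> L)) 0 \<le>
      transition M X (max 0 t) (indicator K) 0 + transition M X (max 0 t) (indicator L) 0" for t
    unfolding transition_def
    by (subst nn_integral_add[symmetric]) (auto simp: indicator_def intro!: nn_integral_mono)
  have "occupation_moment \<zeta> (K \<union> L) \<le> (\<integral>\<^sup>+s.
      ennreal (s powr \<zeta>) * (transition M X (max 0 s) (indicator K) 0 * indicator {0..} s) +
      ennreal (s powr \<zeta>) * (transition M X (max 0 s) (indicator L) 0 * indicator {0..} s) \<partial>lborel)"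
    unfolding occupation_moment_def
    using le by (intro nn_integral_mono) (auto simp flip: distrib_left distrib_right intro!: mult_left_mono mult_right_mono)
  also have "\<dots> = occupation_moment \<zeta> K + occupation_moment \<zeta> L"
    unfolding occupation_moment_def by (rule nn_integral_add) measurable
  finally show ?thesis .
qed

text \<open>One term of the Chapman-Kolmogorov relation: among the paths in K at time s + t, keep
  those at z at time s.\<close>

lemma transition_point_mult_le:
  assumes [measurable]: "{z} \<in> sets borel" "K \<in> sets borel" and s: "s \<ge> 0" and t: "t \<ge> 0"
  shows "transition M X s (indicator {z}) 0 * transition M X t (indicator K) z \<le>
    transition M X (s + t) (indicator K) 0"
proof -
  define r where "r i = (if i = (0::nat) then 0 else s)" for i
  have r: "r 0 = 0" "mono r" "r 1 = s" using s by (auto simp: r_def mono_def)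
  define g :: "(nat \<Rightarrow> 'a) \<Rightarrow> ennreal" where "g f = indicator {z} (f 1)" for f
  have g [measurable]: "g \<in> borel_measurable (PiM {..1} (\<lambda>_. borel))"
    unfolding g_def by measurable
  have [measurable]: "X s \<in> borel_measurable M" by (rule measurable_X[OF s])
  have "transition M X s (indicator {z}) 0 * transition M X t (indicator K) z =
      (\<integral>\<^sup>+\<omega>. indicator {z} (X s \<omega>) * transition M X t (indicator K) z \<partial>M)"
    unfolding transition_def[of _ _ s] by (subst nn_integral_multc) simp_all
  also have "\<dots> = (\<integral>\<^sup>+\<omega>. g (\<lambda>i\<in>{..1}. X (r i) \<omega>) * transition M X t (indicator K) (X (r 1) \<omega>) \<partial>M)"
    unfolding g_def r(3) by (intro nn_integral_cong) (auto simp: indicator_def r(3)[simplified])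
  also have "\<dots> = (\<integral>\<^sup>+\<omega>. g (\<lambda>i\<in>{..1}. X (r i) \<omega>) * indicator K (X (r 1 + t) \<omega>) \<partial>M)"
    by (rule markov_property[symmetric, OF r(1,2) t g]) simp
  also have "\<dots> \<le> transition M X (s + t) (indicator K) 0"
    unfolding transition_def r(3) by (intro nn_integral_mono) (auto simp: g_def indicator_def)
  finally show ?thesis .
qed

text \<open>Passing through z costs a delay t, and s^\<zeta> \<le> (s + t)^\<zeta> because \<zeta>
  \<ge> 0. With K = {0} this is how irreducibility transfers finiteness from 0 to z.\<close>

lemma occupation_moment_point_mult_le:
  assumes [measurable]: "{z} \<in> sets borel" "K \<in> sets borel" and t: "t \<ge> 0" and \<zeta>: "\<zeta> \<ge> 0"
  shows "occupation_moment \<zeta> {z} * transition M X t (indicator K) z \<le> occupation_moment \<zeta> K"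
proof -
  let ?p = "\<lambda>L s. transition M X (max 0 s) (indicator L) 0"
  let ?q = "transition M X t (indicator K) z"
  have "occupation_moment \<zeta> {z} * ?q =
      (\<integral>\<^sup>+s. ennreal (s powr \<zeta>) * (?p {z} s * indicator {0..} s) * ?q \<partial>lborel)"
    unfolding occupation_moment_def by (rule nn_integral_multc[symmetric]) measurable
  also have "\<dots> \<le> (\<integral>\<^sup>+s. ennreal ((t + 1 * s) powr \<zeta>) * (?p K (t + 1 * s) * indicator {0..} (t + 1 * s)) \<partial>lborel)"
  proof (rule nn_integral_mono)
    fix s :: real
    show "ennreal (s powr \<zeta>) * (?p {z} s * indicator {0..} s) * ?q \<le>
      ennreal ((t + 1 * s) powr \<zeta>) * (?p K (t + 1 * s) * indicator {0..} (t + 1 * s))"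
    proof (cases "s \<ge> 0")
      case True
      then have "ennreal (s powr \<zeta>) * (?p {z} s * ?q) \<le> ennreal ((t + s) powr \<zeta>) * ?p K (t + s)"
        using transition_point_mult_le[OF assms(1,2) True t] t \<zeta>
        by (intro mult_mono ennreal_leI powr_mono2) (simp_all add: max_absorb2 add.commute)
      with True t show ?thesis by (simp add: mult.assoc)
    qed simp
  qed
  also have "\<dots> = occupation_moment \<zeta> K"
    unfolding occupation_moment_def by (subst nn_integral_real_affine[of _ 1 t]) simp_all
  finally show ?thesis .
qed

text \<open>Started at 0, almost every path stays in B for a positive random time by right
  continuity, so its occupation time cannot vanish almost surely.\<close>

lemma green_pos:
  assumes B: "open B" "0 \<in> B"
  shows "green M X (indicator B) 0 > 0"
proof (rule ccontr)
  have [measurable]: "B \<in> sets borel" using B by simp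
  interpret pair_sigma_finite lborel M ..
  assume "\<not> green M X (indicator B) 0 > 0"
  then have "0 = green M X (indicator B) 0" by (simp add: zero_less_iff_neq_zero)
  also have "\<dots> = (\<integral>\<^sup>+u. \<integral>\<^sup>+\<omega>. indicator B (X (max 0 u) \<omega>) * indicator {0..} u \<partial>M \<partial>lborel)"
    unfolding green_eq transition_def by (simp add: nn_integral_multc)
  also have "\<dots> = (\<integral>\<^sup>+\<omega>. \<integral>\<^sup>+u. indicator B (X (max 0 u) \<omega>) * indicator {0..} u \<partial>lborel \<partial>M)"
    by (rule Fubini'[symmetric]) measurable
  finally have "AE \<omega> in M. (\<integral>\<^sup>+u. indicator B (X (max 0 u) \<omega>) * indicator {0..} u \<partial>lborel) = 0"
    by (subst (asm) eq_commute, subst (asm) nn_integral_0_iff_AE) simp_all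
  with start_0 have "AE \<omega> in M. False"
    using AE_space
  proof eventually_elim
    case (elim \<omega>)
    with B obtain e where e: "e > 0" "\<And>u. 0 \<le> u \<Longrightarrow> u < 0 + e \<Longrightarrow> X u \<omega> \<in> B"
      using right_continuous_at[of \<omega> 0 B] by auto
    have "ennreal e = (\<integral>\<^sup>+u. indicator {0..<e} u \<partial>lborel)" using e(1) by simp
    also have "\<dots> \<le> (\<integral>\<^sup>+u. indicator B (X (max 0 u) \<omega>) * indicator {0..} u \<partial>lborel)"
      using e(2) by (intro nn_integral_mono) (auto simp: indicator_def max_absorb2)
    finally show ?case using elim e(1) by simp
  qed
  then show False by simp
qed

text \<open>\<open>ennreal_powr\<close> at exponent 0 is 1 even for an infinite last exit
  time.\<close>

lemma last_exit_moment_0: "(\<integral>\<^sup>+\<omega>. ennreal_powr (last_exit X B \<omega>) 0 \<partial>M) < \<infinity>"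
  by (simp add: ennreal_powr_def emeasure_space_1)

end

section \<open>Polish groups and countable discrete groups as state spaces\<close>

lemma regular_levy_process_polish:
  fixes X :: "real \<Rightarrow> 'w \<Rightarrow> 'a :: {polish_space, topological_ab_group_add}"
  assumes "levy_process M X"
  shows "regular_levy_process M X"
proof (intro regular_levy_process.intro regular_levy_process_axioms.intro assms)
  show "(\<lambda>p. fst p + snd p :: 'a) \<in> borel \<Otimes>\<^sub>M borel \<rightarrow>\<^sub>M borel" by measurable
  fix U :: "'a set" assume "open U"
  show "\<exists>f. continuous_on UNIV f \<and> U = {x. f x > (0::real)}"
  \<comment> \<open>The distance to the complement is the required function, except that
    \<open>infdist\<close> to the empty set is 0 by convention.\<close>
  proof (cases "U = UNIV")
    case False
    then have "- U \<noteq> {}" by auto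
    with \<open>open U\<close> have "x \<in> - U \<longleftrightarrow> infdist x (- U) = 0" for x
      by (intro in_closed_iff_infdist_zero) auto
    then have "U = {x. infdist x (- U) > 0}"
      using infdist_nonneg[of _ "- U"] by (auto simp: less_le)
    then show ?thesis by (intro exI[of _ "\<lambda>x. infdist x (- U)"]) (simp add: continuous_on_infdist)
  qed (auto intro!: exI[of _ "\<lambda>_. 1"])
qed

text \<open>Any subset of the product is a countable union of one-point rectangles, so all preimages
  under addition are measurable; and every indicator is continuous.\<close>

lemma regular_levy_process_discrete:
  fixes X :: "real \<Rightarrow> 'w \<Rightarrow> 'a :: {countable, discrete_topology, ab_group_add}"
  assumes "levy_process M X"
  shows "regular_levy_process M X"
proof (intro regular_levy_process.intro regular_levy_process_axioms.intro assms)
  show "(\<lambda>p. fst p + snd p :: 'a) \<in> borel \<Otimes>\<^sub>M borel \<rightarrow>\<^sub>M borel"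
  proof (rule measurableI)
    fix A :: "'a set"
    have "(\<lambda>p. fst p + snd p) -` A \<inter> space (borel \<Otimes>\<^sub>M borel) =
        (\<Union>p\<in>(\<lambda>p. fst p + snd p) -` A. {fst p} \<times> {snd p})"
      by (auto simp: space_pair_measure)
    also have "\<dots> \<in> sets (borel \<Otimes>\<^sub>M borel)"
    proof (rule sets.countable_UN')
      have "{x} \<times> {y} \<in> sets (borel \<Otimes>\<^sub>M borel)" for x y :: 'a
        by (intro pair_measureI borel_open Topological_Spaces.open_discrete)
      then show "(\<lambda>p. {fst p} \<times> {snd p}) ` ((\<lambda>p. fst p + snd p :: 'a) -` A) \<subseteq> sets (borel \<Otimes>\<^sub>M borel)"
        by blast
    qed simp
    finally show "(\<lambda>p. fst p + snd p) -` A \<inter> space (borel \<Otimes>\<^sub>M borel) \<in> sets (borel \<Otimes>\<^sub>M borel)" .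
  qed simp
  fix U :: "'a set"
  have "continuous_on UNIV (indicat_real U)"
    by (simp add: continuous_on_open_vimage Topological_Spaces.open_discrete)
  moreover have "U = {x. indicat_real U x > 0}" by (auto simp: indicator_def)
  ultimately show "\<exists>f. continuous_on UNIV f \<and> U = {x. f x > (0::real)}" by blast
qed

theorem degree_eq_last_exit_balls:
  fixes X :: "real \<Rightarrow> 'w \<Rightarrow> 'a :: {polish_space, topological_ab_group_add}"
  assumes translate: "\<And>(A :: 'a set) x. bounded A \<Longrightarrow> bounded ((+) x ` A)"
    and levy: "levy_process M X"
    and sup: "\<And>a r. r > 0 \<Longrightarrow> (SUP x\<in>cball a r. green M X (indicator (cball a r)) x) < \<infinity>"
    and inf: "\<And>a r c s. r > 0 \<Longrightarrow> s > 0 \<Longrightarrow> cball c s \<subseteq> interior (cball a r) \<Longrightarrow>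
         (INF x\<in>cball c s. green M X (indicator (cball a r)) x) > 0"
  shows "degree_of_transience bounded M X =
            Sup {ereal \<zeta> |\<zeta>. \<zeta> \<ge> 0 \<and>
              (\<forall>R>0. (\<integral>\<^sup>+\<omega>. ennreal_powr (last_exit X (ball 0 R) \<omega>) \<zeta> \<partial>M) < \<infinity>)}"
proof -
  interpret regular_levy_process M X by (rule regular_levy_process_polish[OF levy])
  have degree: "degree_of_transience bounded M X =
      Sup {ereal \<zeta> |\<zeta>. \<zeta> > -1 \<and> (\<forall>K\<in>{ball 0 R |R. R > 0}. occupation_moment \<zeta> K < \<infinity>)}"
  proof (rule degree_of_transience_eq)
    fix A :: "'a set" and x assume "bounded A"
    \<comment> \<open>The metric need not be translation invariant; \<open>translate\<close> is what
      makes A - x bounded.\<close>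
    then obtain R where "R > 0" "(+) (- x) ` A \<subseteq> ball 0 R"
      using bounded_subset_ballD[OF translate] by blast
    then show "\<exists>K\<in>{ball 0 R |R. R > 0}. \<forall>y\<in>A. y - x \<in> K"
      by (intro bexI[of _ "ball 0 R"]) (auto simp: image_subset_iff)
  qed auto
  have C: "green M X (indicator (ball 0 R)) x \<le> (SUP x\<in>cball 0 R. green M X (indicator (cball 0 R)) x)"
    if "x \<in> ball 0 R" for R x
  proof -
    have "green M X (indicator (ball 0 R)) x \<le> green M X (indicator (cball 0 R)) x"
      unfolding green_def transition_def
      by (intro nn_integral_mono mult_right_mono) (auto simp: indicator_def)
    also have "\<dots> \<le> (SUP x\<in>cball 0 R. green M X (indicator (cball 0 R)) x)"
      using that by (intro SUP_upper) auto
    finally show ?thesis .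
  qed
  have "(\<forall>R>0. occupation_moment \<zeta> (ball 0 R) < \<infinity>) \<longleftrightarrow>
      (\<forall>R>0. (\<integral>\<^sup>+\<omega>. ennreal_powr (last_exit X (ball 0 R) \<omega>) \<zeta> \<partial>M) < \<infinity>)" (is "?P \<longleftrightarrow> ?Q")
    if \<zeta>: "\<zeta> > 0" for \<zeta>
  proof
    assume P: ?P
    show ?Q
    proof (intro allI impI)
      fix R :: real assume R: "R > 0"
      \<comment> \<open>The open ball of radius R sits in its closed ball, which lies in the
        interior of the closed ball of radius R + 1, where the lower bound \<open>inf\<close>
        applies. Radius R + 2 below leads back to an open ball.\<close>
      define c where "c = (INF x\<in>cball 0 R. green M X (indicator (cball 0 (R + 1))) x)"
      have "ball 0 (R + 1) \<subseteq> interior (cball (0::'a) (R + 1))"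
        by (intro interior_maximal) auto
      then have "cball 0 R \<subseteq> interior (cball (0::'a) (R + 1))" by force
      then have "c > 0" unfolding c_def using R by (intro inf) auto
      have "c * (\<integral>\<^sup>+\<omega>. ennreal_powr (last_exit X (ball 0 R) \<omega>) \<zeta> \<partial>M) \<le> occupation_moment \<zeta> (cball 0 (R + 1))"
        by (rule last_exit_moment_le[OF _ _ \<zeta>]) (auto simp: c_def intro!: INF_lower)
      also have "\<dots> \<le> occupation_moment \<zeta> (ball 0 (R + 2))"
        by (rule occupation_moment_mono) auto
      also have "\<dots> < \<infinity>" using P R by simp
      finally show "(\<integral>\<^sup>+\<omega>. ennreal_powr (last_exit X (ball 0 R) \<omega>) \<zeta> \<partial>M) < \<infinity>"
        using \<open>c > 0\<close> by (auto simp: ennreal_mult_less_top)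
    qed
  next
    assume Q: ?Q
    show ?P
    proof (intro allI impI)
      fix R :: real assume R: "R > 0"
      have "occupation_moment \<zeta> (ball 0 R) \<le> (SUP x\<in>cball 0 R. green M X (indicator (cball 0 R)) x) *
          (\<integral>\<^sup>+\<omega>. ennreal_powr (last_exit X (ball 0 R) \<omega>) \<zeta> \<partial>M)"
        by (rule occupation_moment_le[OF _ \<zeta> C]) auto
      also have "\<dots> < \<infinity>" using Q R sup[OF R, of 0] by (simp add: ennreal_mult_less_top)
      finally show "occupation_moment \<zeta> (ball 0 R) < \<infinity>" .
    qed
  qed
  moreover have "\<forall>R>0. occupation_moment 0 (ball 0 R) < \<infinity>"
    using occupation_moment_0_le C sup[of _ 0] by (meson centre_in_ball le_less_trans)
  ultimately show ?thesis
    unfolding degree using last_exit_moment_0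
    by (intro Sup_ereal_nonneg_eq) (simp_all add: Ball_def, blast+)
qed

text \<open>For B = K = {0} the infimum and the supremum of the Green function over B are the same
  number c, positive by \<open>green_pos\<close> and finite by transience.\<close>

theorem degree_eq_last_exit_discrete:
  fixes X :: "real \<Rightarrow> 'w \<Rightarrow> 'a :: {countable, discrete_topology, ab_group_add}"
  assumes levy: "levy_process M X" and irred: "irreducible_walk M X" and trans: "transient finite M X"
  shows "degree_of_transience finite M X =
            Sup {ereal \<zeta> |\<zeta>. \<zeta> \<ge> 0 \<and>
              (\<integral>\<^sup>+\<omega>. ennreal_powr (last_exit X {0} \<omega>) \<zeta> \<partial>M) < \<infinity>}"
proof -
  interpret regular_levy_process M X by (rule regular_levy_process_discrete[OF levy])
  have sets: "A \<in> sets borel" for A :: "'a set" by (intro borel_open Topological_Spaces.open_discrete)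
  have degree: "degree_of_transience finite M X =
      Sup {ereal \<zeta> |\<zeta>. \<zeta> > -1 \<and> (\<forall>K\<in>{K. finite K}. occupation_moment \<zeta> K < \<infinity>)}"
  proof (rule degree_of_transience_eq)
    fix A :: "'a set" and x assume "finite A"
    then show "\<exists>K\<in>{K. finite K}. \<forall>y\<in>A. y - x \<in> K"
      by (intro bexI[of _ "(\<lambda>y. y - x) ` A"]) auto
  qed (simp add: sets)
  have point: "occupation_moment \<zeta> {z} < \<infinity>" if "occupation_moment \<zeta> {0} < \<infinity>" "\<zeta> \<ge> 0" for \<zeta> z
  proof -
    \<comment> \<open>Irreducibility from z to 0: at this t the walk started at z is at 0 with
      positive probability, the factor to be divided out.\<close>
    obtain t where t: "t \<ge> 0" "measure M {\<omega> \<in> space M. z + X t \<omega> = 0} > 0"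
      using irred by (auto simp: irreducible_walk_def)
    have [measurable]: "{\<omega> \<in> space M. z + X t \<omega> = 0} \<in> sets M"
    proof -
      have "X t -` {- z} \<inter> space M \<in> sets M"
        by (rule measurable_sets[OF measurable_X[OF t(1)] sets])
      also have "X t -` {- z} \<inter> space M = {\<omega> \<in> space M. z + X t \<omega> = 0}"
        by (auto simp: eq_neg_iff_add_eq_0 add.commute)
      finally show ?thesis .
    qed
    have "transition M X t (indicator {0}) z =
        (\<integral>\<^sup>+\<omega>. indicator {\<omega> \<in> space M. z + X t \<omega> = 0} \<omega> \<partial>M)"
      unfolding transition_def by (intro nn_integral_cong) (simp add: indicator_def)
    also have "\<dots> > 0" using t(2) by (simp add: emeasure_eq_measure)
    finally have q: "transition M X t (indicator {0}) z > 0" .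
    have "occupation_moment \<zeta> {z} * transition M X t (indicator {0}) z \<le> occupation_moment \<zeta> {0}"
      by (rule occupation_moment_point_mult_le[OF sets sets t(1) that(2)])
    also note that(1)
    finally show ?thesis using q by (auto simp: ennreal_mult_less_top)
  qed
  \<comment> \<open>A finite set is a finite union of points, each controlled by
    \<open>point\<close>. Exponents \<zeta> \<ge> 0 are all that \<open>Sup_ereal_nonneg_eq\<close>
    asks about.\<close>
  have fin: "(\<forall>K\<in>{K. finite K}. occupation_moment \<zeta> K < \<infinity>) \<longleftrightarrow> occupation_moment \<zeta> {0} < \<infinity>"
    if \<zeta>: "\<zeta> \<ge> 0" for \<zeta>
  proof
    assume 0: "occupation_moment \<zeta> {0} < \<infinity>"
    have "occupation_moment \<zeta> K < \<infinity>" if "finite K" for K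
      using that
    proof induction
      case (insert z K)
      have "occupation_moment \<zeta> (insert z K) \<le> occupation_moment \<zeta> {z} + occupation_moment \<zeta> K"
        using occupation_moment_Un_le[OF sets sets, of \<zeta> "{z}" K] by simp
      also have "\<dots> < \<infinity>" using insert point[OF 0 \<zeta>] by simp
      finally show ?case .
    qed (simp add: occupation_moment_def transition_def)
    then show "\<forall>K\<in>{K. finite K}. occupation_moment \<zeta> K < \<infinity>" by blast
  qed simp
  define c where "c = green M X (indicator {0}) 0"
  have "c > 0" unfolding c_def by (rule green_pos[OF Topological_Spaces.open_discrete]) simp
  have "c < \<infinity>"
  proof -
    have "(SUP x. green M X (\<lambda>y. ennreal (indicat_real {0} y)) x) < \<infinity>"
    proof -
      have "continuous_on UNIV (indicat_real {0 :: 'a})"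
        by (simp add: continuous_on_open_vimage Topological_Spaces.open_discrete)
      moreover have "{x. indicat_real {0 :: 'a} x \<noteq> 0} = {0}" by (auto simp: indicator_def)
      ultimately show ?thesis using trans unfolding transient_def by simp
    qed
    moreover have "c \<le> (SUP x. green M X (\<lambda>y. ennreal (indicat_real {0} y)) x)"
      unfolding c_def ennreal_indicator by (rule SUP_upper) simp
    ultimately show ?thesis by (rule le_less_trans[rotated])
  qed
  have iff_pos: "occupation_moment \<zeta> {0} < \<infinity> \<longleftrightarrow> (\<integral>\<^sup>+\<omega>. ennreal_powr (last_exit X {0} \<omega>) \<zeta> \<partial>M) < \<infinity>"
    if \<zeta>: "\<zeta> > 0" for \<zeta>
  proof
    have "c * (\<integral>\<^sup>+\<omega>. ennreal_powr (last_exit X {0} \<omega>) \<zeta> \<partial>M) \<le> occupation_moment \<zeta> {0}"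
      by (rule last_exit_moment_le[OF Topological_Spaces.open_discrete sets \<zeta>]) (simp add: c_def)
    also assume "occupation_moment \<zeta> {0} < \<infinity>"
    finally show "(\<integral>\<^sup>+\<omega>. ennreal_powr (last_exit X {0} \<omega>) \<zeta> \<partial>M) < \<infinity>"
      using \<open>c > 0\<close> by (auto simp: ennreal_mult_less_top)
  next
    assume *: "(\<integral>\<^sup>+\<omega>. ennreal_powr (last_exit X {0} \<omega>) \<zeta> \<partial>M) < \<infinity>"
    have "occupation_moment \<zeta> {0} \<le> c * (\<integral>\<^sup>+\<omega>. ennreal_powr (last_exit X {0} \<omega>) \<zeta> \<partial>M)"
      by (rule occupation_moment_le[OF Topological_Spaces.open_discrete \<zeta>]) (simp add: c_def)
    also have "\<dots> < \<infinity>" using * \<open>c < \<infinity>\<close> by (simp add: ennreal_mult_less_top)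
    finally show "occupation_moment \<zeta> {0} < \<infinity>" .
  qed
  have "occupation_moment 0 {0} < \<infinity>"
    using occupation_moment_0_le[of "{0}"] \<open>c < \<infinity>\<close> by (simp add: c_def)
  then show ?thesis
    unfolding degree using fin iff_pos last_exit_moment_0
    by (intro Sup_ereal_nonneg_eq) simp_all
qed

theorem corollary2p2p2:
  fixes M :: "'w measure"
    and X :: "real \<Rightarrow> 'w \<Rightarrow> 'a :: {polish_space, topological_ab_group_add}"
    and N :: "'v measure"
    and Y :: "real \<Rightarrow> 'v \<Rightarrow> 'b :: {countable, discrete_topology, ab_group_add}"
  shows
    "((\<forall>(A :: 'a set) x. bounded A \<longrightarrow> bounded ((+) x ` A)) \<and>
      levy_process M X \<and>
      transient bounded M X \<and>
      (\<forall>a r. r > 0 \<longrightarrow> (SUP x\<in>cball a r. green M X (indicator (cball a r)) x) < \<infinity>) \<and>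
      (\<forall>a r c s. r > 0 \<and> s > 0 \<and> cball c s \<subseteq> interior (cball a r) \<longrightarrow>
         (INF x\<in>cball c s. green M X (indicator (cball a r)) x) > 0)
      \<longrightarrow> degree_of_transience bounded M X =
            Sup {ereal \<zeta> |\<zeta>. \<zeta> \<ge> 0 \<and>
              (\<forall>R>0. (\<integral>\<^sup>+\<omega>. ennreal_powr (last_exit X (ball 0 R) \<omega>) \<zeta> \<partial>M) < \<infinity>)})
     \<and>
     (levy_process N Y \<and>
      irreducible_walk N Y \<and>
      transient finite N Y
      \<longrightarrow> degree_of_transience finite N Y =
            Sup {ereal \<zeta> |\<zeta>. \<zeta> \<ge> 0 \<and>
              (\<integral>\<^sup>+\<omega>. ennreal_powr (last_exit Y {0} \<omega>) \<zeta> \<partial>N) < \<infinity>})"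
  by (intro conjI impI degree_eq_last_exit_balls degree_eq_last_exit_discrete) blast+

end
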